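(* Let $\varphi:\mathbb{D}\to\mathbb{D}$ be holomorphic, $\varphi\notin\mathrm{Aut}(\mathbb{D})$, with $\varphi(\alpha)=\alpha$ and $\varphi'(\alpha)\neq0$ for some $\alpha\in\mathbb{D}$, and put $\lambda_n=\varphi'(\alpha)^n$ for $n\in\mathbb{N}_0$. Let $X$ be a Banach space with $X\hookrightarrow\mathrm{Hol}(\mathbb{D})$ and $C_\varphi X\subset X$, and let $T={C_\varphi}_{|X}$. Assume that $\dim X=\infty$. Denote by $\sigma_0(T)$ the connected component of $0$ in $\sigma(T)$, and let $J_0=\{n\in\mathbb{N}_0:\lambda_n\text{ is an isolated point of }\sigma(T)\}$. Then $$\sigma(T)=\sigma_0(T)\cup\{\lambda_n:n\in J_0\}.$$ In particular, $\sigma_0(T)$ is the essential spectrum of $T$.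
   Context: $\mathbb{D}$ is the open unit disc, $\mathrm{Hol}(\mathbb{D})$ the Fréchet space of holomorphic functions on $\mathbb{D}$ (uniform convergence on compact sets), $\mathrm{Aut}(\mathbb{D})$ the group of holomorphic automorphisms of $\mathbb{D}$, $\mathbb{N}_0=\{0,1,2,\dots\}$, $C_\varphi f=f\circ\varphi$. $X\hookrightarrow\mathrm{Hol}(\mathbb{D})$ means that $X$ is a linear subspace of $\mathrm{Hol}(\mathbb{D})$ with continuous inclusion. $T$ is a bounded operator on $X$ by the closed graph theorem; $\sigma(T)$ is its spectrum. When $\dim X=\infty$ one has $0\in\sigma(T)$. A point $\lambda\in\sigma(T)$ is a Riesz point if it is isolated in $\sigma(T)$ and there is a decomposition $X=X_1\oplus X_2$ into closed $T$-invariant subspaces with $\dim X_1<\infty$, $\sigma(T_{|X_1})=\{\lambda\}$ and $(\lambda\,\mathrm{Id}-T)_{|X_2}$ invertible. The essential spectrum of $T$ is $\sigma_e(T)=\{\lambda\in\sigma(T):\lambda\text{ is not a Riesz point}\}$. *)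

theory Defs
  imports "HOL-Complex_Analysis.Complex_Analysis"
begin

text \<open>
  The libraries only have real Banach spaces, so the complex scalar multiplication is added here.
  The unit law for scalars follows from \<open>scaleR_scaleC\<close>.
\<close>

class complex_banach = banach +
  fixes scaleC :: "complex \<Rightarrow> 'a \<Rightarrow> 'a"  (infixr \<open>*\<^sub>C\<close> 75)
  assumes scaleC_add_right: "a *\<^sub>C (x + y) = a *\<^sub>C x + a *\<^sub>C y"
    and scaleC_add_left: "(a + b) *\<^sub>C x = a *\<^sub>C x + b *\<^sub>C x"
    and scaleC_scaleC: "a *\<^sub>C (b *\<^sub>C x) = (a * b) *\<^sub>C x"
    and scaleR_scaleC: "scaleR r x = complex_of_real r *\<^sub>C x"
    and norm_scaleC: "norm (a *\<^sub>C x) = cmod a * norm x"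

interpretation complex_vector:
  vector_space "scaleC :: complex \<Rightarrow> 'a \<Rightarrow> 'a::complex_banach"
proof
  fix x :: 'a
  show "1 *\<^sub>C x = x"
    using scaleR_scaleC[of 1 x] by simp
qed (simp_all add: scaleC_add_right scaleC_add_left scaleC_scaleC)

definition finite_dimensional :: "'a::complex_banach set \<Rightarrow> bool" where
  "finite_dimensional Y \<longleftrightarrow> (\<exists>B. finite B \<and> complex_vector.span B = Y)"

abbreviation unit_disc :: "complex set"  (\<open>\<D>\<close>) where
  "\<D> \<equiv> ball 0 1"

definition disc_automorphism :: "(complex \<Rightarrow> complex) \<Rightarrow> bool" where
  "disc_automorphism \<phi> \<longleftrightarrow>
     \<phi> holomorphic_on \<D> \<and> \<phi> ` \<D> \<subseteq> \<D> \<and>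
     (\<exists>\<psi>. \<psi> holomorphic_on \<D> \<and> \<psi> ` \<D> \<subseteq> \<D> \<and>
          (\<forall>z\<in>\<D>. \<psi> (\<phi> z) = z) \<and> (\<forall>z\<in>\<D>. \<phi> (\<psi> z) = z))"

text \<open>
  A Banach space of holomorphic functions on the disc is a type \<open>'a\<close> with an injective linear
  map \<open>\<iota>\<close> reading each element as a function, of which only the values on the disc matter.
  The last condition is continuity of \<open>\<iota>\<close> for the topology of uniform convergence on compact
  subsets of the disc.
\<close>

definition continuously_embedded_in_Hol ::
    "('a::complex_banach \<Rightarrow> complex \<Rightarrow> complex) \<Rightarrow> bool" where
  "continuously_embedded_in_Hol \<iota> \<longleftrightarrow>
     (\<forall>x. \<iota> x holomorphic_on \<D>) \<and>
     (\<forall>x y. \<forall>z\<in>\<D>. \<iota> (x + y) z = \<iota> x z + \<iota> y z) \<and>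
     (\<forall>c x. \<forall>z\<in>\<D>. \<iota> (c *\<^sub>C x) z = c * \<iota> x z) \<and>
     (\<forall>x y. (\<forall>z\<in>\<D>. \<iota> x z = \<iota> y z) \<longrightarrow> x = y) \<and>
     (\<forall>x K. compact K \<and> K \<subseteq> \<D> \<longrightarrow> uniform_limit K \<iota> (\<iota> x) (at x))"

text \<open>
  Invertibility as a bounded operator on the subspace \<open>Y\<close>. It is used for linear \<open>A\<close>, whose
  inverse is then automatically linear.
\<close>

definition invertible_on :: "'a::complex_banach set \<Rightarrow> ('a \<Rightarrow> 'a) \<Rightarrow> bool" where
  "invertible_on Y A \<longleftrightarrow>
     bij_betw A Y Y \<and> (\<exists>K. \<forall>y\<in>Y. norm (inv_into Y A y) \<le> K * norm y)"

definition spectrum_on :: "'a::complex_banach set \<Rightarrow> ('a \<Rightarrow> 'a) \<Rightarrow> complex set" where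
  "spectrum_on Y T = {\<mu>. \<not> invertible_on Y (\<lambda>x. \<mu> *\<^sub>C x - T x)}"

abbreviation spectrum :: "('a::complex_banach \<Rightarrow> 'a) \<Rightarrow> complex set"  (\<open>\<sigma>\<close>) where
  "\<sigma> T \<equiv> spectrum_on UNIV T"

definition riesz_point :: "('a::complex_banach \<Rightarrow> 'a) \<Rightarrow> complex \<Rightarrow> bool" where
  "riesz_point T \<mu> \<longleftrightarrow>
     \<mu> isolated_in \<sigma> T \<and>
     (\<exists>X1 X2.
        complex_vector.subspace X1 \<and> closed X1 \<and> T ` X1 \<subseteq> X1 \<and>
        complex_vector.subspace X2 \<and> closed X2 \<and> T ` X2 \<subseteq> X2 \<and>
        X1 \<inter> X2 = {0} \<and> {x + y | x y. x \<in> X1 \<and> y \<in> X2} = UNIV \<and>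
        finite_dimensional X1 \<and> spectrum_on X1 T = {\<mu>} \<and>
        invertible_on X2 (\<lambda>x. \<mu> *\<^sub>C x - T x))"

definition essential_spectrum :: "('a::complex_banach \<Rightarrow> 'a) \<Rightarrow> complex set"  (\<open>\<sigma>\<^sub>e\<close>) where
  "\<sigma>\<^sub>e T = {\<mu> \<in> \<sigma> T. \<not> riesz_point T \<mu>}"

definition zero_component :: "('a::complex_banach \<Rightarrow> 'a) \<Rightarrow> complex set"  (\<open>\<sigma>\<^sub>0\<close>) where
  "\<sigma>\<^sub>0 T = connected_component_set (\<sigma> T) 0"

end

theory Submission imports Defs begin

text \<open>
  Let \<open>\<mu>\<close> lie in the spectrum but not in the component of \<open>0\<close>. By the Sura-Bura theorem there is a
  relatively clopen part \<open>S\<close> of the spectrum that contains \<open>\<mu>\<close> and stays away from \<open>0\<close>. Orbits of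
  \<open>\<phi>\<close> converge to \<open>\<alpha>\<close> geometrically, so for \<open>x\<close> vanishing to a high order \<open>N\<close> at \<open>\<alpha>\<close> the series
  \<open>\<Sum>n. (x \<circ> \<phi>\<^sup>n) / \<zeta>\<^sup>n\<^sup>+\<^sup>1\<close> converges in \<open>Hol(\<D>)\<close> near \<open>S\<close> and extends the resolvent \<open>(\<zeta> - T)\<^sup>-\<^sup>1 x\<close>
  holomorphically across \<open>S\<close>. A Cauchy formula involving only points \<open>\<zeta>\<close> off the spectrum shows that
  the extension still takes values in the Banach space, so that \<open>\<mu> - T\<close> is bijective on the subspace
  of elements vanishing to order \<open>N\<close>. That subspace has finite codimension and \<open>T\<close> acts on the
  successive quotients by the distinct numbers \<open>\<phi>'(\<alpha>)\<^sup>k\<close>; hence \<open>\<mu>\<close> is one of them and is a Riesz point.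

  Contour integrals around \<open>S\<close> are replaced by area integrals against the conjugate derivative of a
  cutoff function that is \<open>1\<close> near \<open>S\<close>, so no cycle surrounding \<open>S\<close> has to be constructed.

  Conversely, if \<open>T\<close> is invertible on an invariant subspace \<open>V\<close>, then \<open>x = (T\<^sup>-\<^sup>n x) \<circ> \<phi>\<^sup>n\<close> forces the elements
  of \<open>V\<close> vanishing to a high order to be \<open>0\<close>, so \<open>V\<close> has finite dimension. Thus \<open>0\<close> lies in the
  spectrum and is not a Riesz point.
\<close>

section \<open>The closed graph theorem\<close>

text \<open>The Baire half of the closed graph theorem: \<open>Y\<close> is the union of the
  closures of the sublevel sets of \<open>norm (S x)\<close>, so one closure contains a relative
  ball. Differences of points near its centre then approximate any \<open>y\<close> with controlled
  image.\<close>

lemma nearby_approximants: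
  fixes S :: "'a::banach \<Rightarrow> 'b::real_normed_vector"
  assumes Y: "subspace Y" and clY: "closed Y"
    and add: "\<And>x y. x \<in> Y \<Longrightarrow> y \<in> Y \<Longrightarrow> S (x + y) = S x + S y"
    and scale: "\<And>c x. x \<in> Y \<Longrightarrow> S (c *\<^sub>R x) = c *\<^sub>R S x"
  obtains K where "K > 0" "\<And>y e. y \<in> Y \<Longrightarrow> e > 0 \<Longrightarrow>
      \<exists>x\<in>Y. norm (y - x) < e \<and> norm (S x) \<le> K * norm y"
proof -
  define F where "F n = closure {x \<in> Y. norm (S x) \<le> real n}" for n
  have diff: "S (x - y) = S x - S y" if "x \<in> Y" "y \<in> Y" for x y
    using add[of x "(-1) *\<^sub>R y"] scale[of y "-1"] that Y by (simp add: subspace_neg)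
  have FY: "F n \<subseteq> Y" for n
    unfolding F_def using clY by (intro closure_minimal) auto
  have UF: "\<Union>(range F) = Y"
  proof
    show "Y \<subseteq> \<Union>(range F)"
    proof
      fix x assume "x \<in> Y"
      moreover obtain n where "norm (S x) \<le> real n"
        using real_arch_simple by blast
      ultimately have "x \<in> F n"
        unfolding F_def by (intro subsetD[OF closure_subset]) simp
      then show "x \<in> \<Union>(range F)"
        by (rule UN_I[OF UNIV_I])
    qed
  qed (use FY in auto)
  have cm: "completely_metrizable_space (top_of_set Y)"
    by (rule completely_metrizable_space_closedin[OF completely_metrizable_space_euclidean])
      (use clY in \<open>simp only: closed_closedin\<close>)
  have "\<exists>n. top_of_set Y interior_of F n \<noteq> {}"
  proof (rule ccontr, unfold not_ex not_not)
    assume int: "\<forall>n. top_of_set Y interior_of F n = {}"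
    have "closedin (top_of_set Y) (F n)" for n
      using FY[of n] by (rule closed_subset) (simp add: F_def)
    then have "closedin (top_of_set Y) Z \<and> top_of_set Y interior_of Z = {}" if "Z \<in> range F" for Z
    proof -
      from that obtain n where "Z = F n"
        by (rule rangeE)
      then show ?thesis
        using int \<open>\<And>n. closedin (top_of_set Y) (F n)\<close> by simp
    qed
    then have "top_of_set Y interior_of \<Union>(range F) = {}"
      by (intro Baire_category_alt[OF disjI1[OF cm]]) simp_all
    then have "top_of_set Y interior_of Y = {}"
      by (simp only: UF)
    moreover have "top_of_set Y interior_of Y = Y"
      using interior_of_topspace[of "top_of_set Y"] by simp
    ultimately show False
      using subspace_0[OF Y] by simp
  qed
  then obtain n a where "a \<in> top_of_set Y interior_of F n"
    by (meson ex_in_conv)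
  then obtain W where W: "openin (top_of_set Y) W" "a \<in> W" "W \<subseteq> F n"
    by (auto simp: interior_of_def)
  obtain d where "d > 0" and d: "\<And>x. x \<in> Y \<Longrightarrow> dist x a < d \<Longrightarrow> x \<in> F n" and a: "a \<in> Y"
    using W unfolding openin_euclidean_subtopology_iff by (meson subsetD)
  show ?thesis
  proof
    \<comment> \<open>Two points of the sublevel set have images differing by at most
      \<open>2 * n\<close>, and rescaling by \<open>1 / t\<close> contributes
      \<open>2 * norm y / d\<close>. Using \<open>n + 1\<close> keeps the constant positive when
      \<open>n = 0\<close>.\<close>
    show "4 * (real n + 1) / d > 0"
      using \<open>d > 0\<close> by simp
    fix y :: 'a and e :: real
    assume y: "y \<in> Y" and "e > 0"
    show "\<exists>x\<in>Y. norm (y - x) < e \<and> norm (S x) \<le> 4 * (real n + 1) / d * norm y"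
    proof (cases "y = 0")
      case True
      then show ?thesis
        using \<open>e > 0\<close> scale[of 0 0] subspace_0[OF Y] by (intro bexI[of _ 0]) auto
    next
      case False
      \<comment> \<open>This scaling moves \<open>a\<close> by exactly \<open>d / 2\<close> in the
        direction of \<open>y\<close>, so the shifted point stays in the ball.\<close>
      define t where "t = d / (2 * norm y)"
      have "t > 0"
        using False \<open>d > 0\<close> by (simp add: t_def)
      have "a \<in> F n"
        using d[OF a] \<open>d > 0\<close> by simp
      moreover have "a + t *\<^sub>R y \<in> F n"
        using False \<open>d > 0\<close> a y Y
        by (intro d) (auto simp: dist_norm t_def subspace_add subspace_scale)
      moreover have "t * e / 2 > 0"
        using \<open>t > 0\<close> \<open>e > 0\<close> by simp
      ultimately obtain u v where u: "u \<in> Y" "norm (S u) \<le> n" "dist u a < t * e / 2"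
        and v: "v \<in> Y" "norm (S v) \<le> n" "dist v (a + t *\<^sub>R y) < t * e / 2"
        unfolding F_def closure_approachable by (metis (no_types, lifting) mem_Collect_eq)
      define x where "x = (1 / t) *\<^sub>R (v - u)"
      have "x \<in> Y"
        unfolding x_def using u v Y by (simp add: subspace_diff subspace_scale)
      moreover have "norm (y - x) < e"
      proof -
        have "t *\<^sub>R (y - x) = (a + t *\<^sub>R y - v) + (u - a)"
          using \<open>t > 0\<close> by (simp add: x_def algebra_simps)
        then have "norm (t *\<^sub>R (y - x)) < t * e / 2 + t * e / 2"
          using u(3) v(3) by (metis add_strict_mono dist_commute dist_norm norm_triangle_lt)
        then show ?thesis
          using \<open>t > 0\<close> by simp
      qed
      moreover have "norm (S x) \<le> 4 * (real n + 1) / d * norm y"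
      proof -
        have "norm (S x) = (1 / t) * norm (S v - S u)"
          unfolding x_def using u v Y \<open>t > 0\<close> by (simp add: scale diff subspace_diff)
        also have "\<dots> \<le> (1 / t) * (2 * (real n + 1))"
          using u v norm_triangle_ineq4[of "S v" "S u"] \<open>t > 0\<close> by (intro mult_left_mono) auto
        finally show ?thesis
          by (simp add: t_def algebra_simps add_divide_distrib)
      qed
      ultimately show ?thesis
        by blast
    qed
  qed
qed

text \<open>Successive approximation: correcting the error repeatedly, with half the tolerance each
  time, gives \<open>f n\<close> tending to \<open>y\<close> whose images have geometrically bounded
  increments. The images converge, and the closed graph identifies their limit as
  \<open>S y\<close>. Linearity is asked on \<open>Y\<close> only, so that inverses defined on a
  subspace are covered.\<close>

lemma closed_graph_bounded:
  fixes S :: "'a::banach \<Rightarrow> 'b::banach"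
  assumes Y: "subspace Y" and clY: "closed Y"
    and add: "\<And>x y. x \<in> Y \<Longrightarrow> y \<in> Y \<Longrightarrow> S (x + y) = S x + S y"
    and scale: "\<And>c x. x \<in> Y \<Longrightarrow> S (c *\<^sub>R x) = c *\<^sub>R S x"
    and graph: "\<And>u x y. (\<And>n. u n \<in> Y) \<Longrightarrow> x \<in> Y \<Longrightarrow> u \<longlonglongrightarrow> x \<Longrightarrow> (\<lambda>n. S (u n)) \<longlonglongrightarrow> y \<Longrightarrow> y = S x"
  obtains K where "\<And>y. y \<in> Y \<Longrightarrow> norm (S y) \<le> K * norm y"
proof -
  obtain K where "K > 0" and K: "\<And>y e. y \<in> Y \<Longrightarrow> e > 0 \<Longrightarrow>
      \<exists>x\<in>Y. norm (y - x) < e \<and> norm (S x) \<le> K * norm y"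
    using nearby_approximants[OF Y clY add scale] by blast
  have "norm (S y) \<le> 2 * K * norm y" if y: "y \<in> Y" for y
  proof (cases "y = 0")
    case True
    then show ?thesis
      using scale[of 0 0] subspace_0[OF Y] by simp
  next
    case False
    define \<epsilon> where "\<epsilon> n = norm y / 2 ^ n" for n
    have \<epsilon>: "\<epsilon> n > 0" for n
      using False by (simp add: \<epsilon>_def)
    \<comment> \<open>The clause for \<open>n = 0\<close> pins the starting value to
      \<open>0\<close>, so that the increments of \<open>S (f n)\<close> telescope without an
      initial term.\<close>
    have "\<exists>f. \<forall>n. (f n \<in> Y \<and> norm (y - f n) \<le> \<epsilon> n \<and> (n = 0 \<longrightarrow> f n = 0)) \<and>
          norm (S (f (Suc n)) - S (f n)) \<le> K * \<epsilon> n"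
      proof (rule dependent_nat_choice)
        show "\<exists>x. x \<in> Y \<and> norm (y - x) \<le> \<epsilon> 0 \<and> (0 = (0::nat) \<longrightarrow> x = 0)"
          using subspace_0[OF Y] by (auto simp: \<epsilon>_def)
      next
        fix x n
        assume x: "x \<in> Y \<and> norm (y - x) \<le> \<epsilon> n \<and> (n = 0 \<longrightarrow> x = 0)"
        obtain w where w: "w \<in> Y" "norm (y - x - w) < \<epsilon> (Suc n)" "norm (S w) \<le> K * norm (y - x)"
          using K[of "y - x"] x y \<epsilon> Y by (metis subspace_diff)
        have "norm (S (x + w) - S x) \<le> K * \<epsilon> n"
          using w x \<open>K > 0\<close> by (auto simp: add intro: order_trans[OF w(3)] mult_left_mono)
        moreover have "x + w \<in> Y" "norm (y - (x + w)) \<le> \<epsilon> (Suc n)"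
          using w x Y by (auto simp: subspace_add algebra_simps)
        ultimately show "\<exists>z. (z \<in> Y \<and> norm (y - z) \<le> \<epsilon> (Suc n) \<and> (Suc n = 0 \<longrightarrow> z = 0)) \<and>
            norm (S z - S x) \<le> K * \<epsilon> n"
          by blast
      qed
    then obtain f where f: "\<And>n. f n \<in> Y" "\<And>n. norm (y - f n) \<le> \<epsilon> n" "f 0 = 0"
      and step: "\<And>n. norm (S (f (Suc n)) - S (f n)) \<le> K * \<epsilon> n"
      by metis
    have S0: "S (f 0) = 0"
      using scale[of 0 0] subspace_0[OF Y] f(3) by simp
    have \<epsilon>_sums: "(\<lambda>n. K * \<epsilon> n) sums (2 * K * norm y)"
      using sums_mult[OF geometric_sums[of "1/2::real"], of "K * norm y"]
      by (simp add: \<epsilon>_def power_divide mult.commute mult.left_commute)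
    have sm: "summable (\<lambda>n. norm (S (f (Suc n)) - S (f n)))"
      using step by (intro summable_comparison_test'[OF sums_summable[OF \<epsilon>_sums], of 0]) auto
    define s where "s = (\<Sum>n. S (f (Suc n)) - S (f n))"
    have "(\<lambda>n. \<Sum>i<n. S (f (Suc i)) - S (f i)) \<longlonglongrightarrow> s"
      unfolding s_def using summable_LIMSEQ[OF summable_norm_cancel[OF sm]] .
    then have "(\<lambda>n. S (f n)) \<longlonglongrightarrow> s"
      by (simp add: sum_lessThan_telescope[of "\<lambda>n. S (f n)"] S0)
    moreover have "f \<longlonglongrightarrow> y"
    proof -
      have "(\<lambda>n. norm y * (1 / 2) ^ n) \<longlonglongrightarrow> 0"
        using tendsto_mult_right_zero[OF LIMSEQ_power_zero[of "1/2::real"]] by simp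
      then have "(\<lambda>n. norm (f n - y)) \<longlonglongrightarrow> 0"
        by (rule Lim_null_comparison[rotated])
          (use f(2) in \<open>auto simp: \<epsilon>_def power_divide norm_minus_commute\<close>)
      then show ?thesis
        using Lim_null tendsto_norm_zero_iff by blast
    qed
    ultimately have "s = S y"
      using graph[of f y s] f(1) y by blast
    moreover have "norm s \<le> 2 * K * norm y"
      unfolding s_def using summable_norm[OF sm] suminf_le[OF step sm sums_summable[OF \<epsilon>_sums]]
        sums_unique[OF \<epsilon>_sums] by linarith
    ultimately show ?thesis
      by simp
  qed
  then show ?thesis
    using that by blast
qed

section \<open>Spectrum and resolvent\<close>

lemma bounded_bilinear_scaleC: "bounded_bilinear (scaleC :: complex \<Rightarrow> 'a \<Rightarrow> 'a::complex_banach)"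
proof
  fix a b :: complex and x y :: 'a and r :: real
  show "(r *\<^sub>R a) *\<^sub>C x = r *\<^sub>R a *\<^sub>C x" "a *\<^sub>C r *\<^sub>R x = r *\<^sub>R a *\<^sub>C x"
    by (simp_all add: scaleR_scaleC scaleC_scaleC scaleR_conv_of_real mult.commute)
  show "\<exists>K. \<forall>a (x :: 'a). norm (a *\<^sub>C x) \<le> norm a * norm x * K"
    by (intro exI[of _ 1]) (simp add: norm_scaleC)
qed (simp_all add: scaleC_add_left scaleC_add_right)

lemma complex_subspace_imp_subspace: "complex_vector.subspace Y \<Longrightarrow> subspace Y"
  by (auto simp: subspace_def complex_vector.subspace_def scaleR_scaleC)

text \<open>The graph of the inverse is closed because \<open>A\<close> is continuous, so the closed
  graph theorem bounds the inverse. From here on only bijectivity has to be checked.\<close>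

lemma invertible_on_closed_subspace:
  assumes Y: "subspace Y" "closed Y" and A: "bounded_linear A" and bij: "bij_betw A Y Y"
  shows "invertible_on Y A"
proof -
  interpret A: bounded_linear A by fact
  have inj: "inj_on A Y" and sur: "A ` Y = Y"
    using bij by (auto simp: bij_betw_def)
  define S where "S = inv_into Y A"
  have SY: "S y \<in> Y" "A (S y) = y" if "y \<in> Y" for y
    using that sur unfolding S_def by (metis inv_into_into, metis f_inv_into_f)
  have SA: "S (A x) = x" if "x \<in> Y" for x
    unfolding S_def using that inj by simp
  obtain K where "\<And>y. y \<in> Y \<Longrightarrow> norm (S y) \<le> K * norm y"
  proof (rule closed_graph_bounded[OF Y, of S])
    show "S (x + y) = S x + S y" if "x \<in> Y" "y \<in> Y" for x y
      using SA[of "S x + S y"] that SY Y(1) by (simp add: A.add subspace_add)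
    show "S (c *\<^sub>R x) = c *\<^sub>R S x" if "x \<in> Y" for c x
      using SA[of "c *\<^sub>R S x"] that SY Y(1) by (simp add: A.scaleR subspace_scale)
    show "y = S x" if u: "\<And>n. u n \<in> Y" "u \<longlonglongrightarrow> x" and x: "x \<in> Y" and lim: "(\<lambda>n. S (u n)) \<longlonglongrightarrow> y" for u x y
    proof -
      have "y \<in> Y"
        using closed_sequentially[OF Y(2) _ lim] SY u by blast
      moreover have "(\<lambda>n. A (S (u n))) \<longlonglongrightarrow> A y"
        using A.tendsto[OF lim] .
      then have "A y = x"
        using u SY by (auto intro: LIMSEQ_unique)
      ultimately show ?thesis
        using SA[of y] by simp
    qed
  qed auto
  then show ?thesis
    unfolding invertible_on_def S_def using bij by blast
qed

text \<open>The bound on the inverse is rewritten as a lower bound for \<open>A\<close>, the form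
  that survives small perturbations.\<close>

lemma invertible_UNIV_iff:
  "invertible_on UNIV A \<longleftrightarrow> bij A \<and> (\<exists>K>0. \<forall>x. norm x \<le> K * norm (A x))"
proof
  assume "invertible_on UNIV A"
  then obtain K where "bij A" and K: "\<And>y. norm (inv A y) \<le> K * norm y"
    unfolding invertible_on_def by auto
  have "norm x \<le> (\<bar>K\<bar> + 1) * norm (A x)" for x
  proof -
    have "norm x \<le> K * norm (A x)"
      using K[of "A x"] \<open>bij A\<close> by (simp add: bij_is_inj)
    also have "\<dots> \<le> (\<bar>K\<bar> + 1) * norm (A x)"
      by (intro mult_right_mono) auto
    finally show ?thesis .
  qed
  then show "bij A \<and> (\<exists>K>0. \<forall>x. norm x \<le> K * norm (A x))"
    using \<open>bij A\<close> by (intro conjI exI[of _ "\<bar>K\<bar> + 1"]) auto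
next
  assume "bij A \<and> (\<exists>K>0. \<forall>x. norm x \<le> K * norm (A x))"
  then obtain K where "bij A" and K: "\<And>x. norm x \<le> K * norm (A x)"
    by auto
  then have "norm (inv A y) \<le> K * norm y" for y
    using K[of "inv A y"] by (simp add: bij_is_surj surj_f_inv_f)
  then show "invertible_on UNIV A"
    unfolding invertible_on_def using \<open>bij A\<close> by auto
qed

text \<open>To solve \<open>A x + D x = y\<close>, iterate the map sending \<open>x\<close> to the
  \<open>A\<close>-preimage of \<open>y - D x\<close>. It contracts distances by
  \<open>1 / 2\<close>, so Banach's fixed point theorem replaces a Neumann series.\<close>

lemma bij_perturb:
  fixes A D :: "'a::banach \<Rightarrow> 'a"
  assumes A: "linear A" and D: "linear D" and "bij A"
    and K: "\<And>x. norm x \<le> K * norm (A x)" "K > 0"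
    and d: "\<And>x. norm (D x) \<le> d * norm x" "d \<ge> 0" "K * d \<le> 1 / 2"
  shows "bij (\<lambda>x. A x + D x)" and "norm x \<le> 2 * K * norm (A x + D x)"
proof -
  interpret A: linear A by fact
  interpret D: linear D by fact
  have bound: "norm x \<le> 2 * K * norm (A x + D x)" for x
  proof -
    have "norm x \<le> K * norm (A x)"
      by (rule K)
    also have "\<dots> \<le> K * (norm (A x + D x) + norm (D x))"
      using K(2) norm_triangle_ineq4[of "A x + D x" "D x"] by (intro mult_left_mono) auto
    also have "\<dots> \<le> K * norm (A x + D x) + K * (d * norm x)"
      using K(2) d(1)[of x] by (simp add: distrib_left mult_left_mono)
    also have "K * (d * norm x) \<le> 1 / 2 * norm x"
      using d(3) by (metis mult.assoc mult_right_mono norm_ge_zero)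
    finally show ?thesis
      by simp
  qed
  show "norm x \<le> 2 * K * norm (A x + D x)"
    by (rule bound)
  have "\<exists>x. A x + D x = y" for y
  proof -
    define f where "f x = inv A (y - D x)" for x
    have Af: "A (f x) = y - D x" for x
      unfolding f_def using \<open>bij A\<close> by (simp add: bij_is_surj surj_f_inv_f)
    have "dist (f x) (f x') \<le> 1 / 2 * dist x x'" for x x'
    proof -
      have "norm (f x - f x') \<le> K * norm (A (f x - f x'))"
        by (rule K)
      also have "\<dots> = K * norm (D (x' - x))"
        by (simp add: A.diff D.diff Af)
      also have "\<dots> \<le> K * (d * norm (x' - x))"
        using d(1) K(2) by (intro mult_left_mono) auto
      also have "\<dots> \<le> 1 / 2 * norm (x' - x)"
        using d(3) by (metis mult.assoc mult_right_mono norm_ge_zero)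
      finally show ?thesis
        by (simp add: dist_norm norm_minus_commute)
    qed
    then obtain x where "f x = x"
      using banach_fix_type[of "1/2" f] by auto
    then show ?thesis
      using Af[of x] by (intro exI[of _ x]) simp
  qed
  moreover have "inj (\<lambda>x. A x + D x)"
  proof (rule injI)
    fix x y assume "A x + D x = A y + D y"
    then have "A (x - y) + D (x - y) = 0"
      by (simp add: A.diff D.diff add_diff_add[symmetric])
    then show "x = y"
      using bound[of "x - y"] by simp
  qed
  ultimately show "bij (\<lambda>x. A x + D x)"
    unfolding bij_def surj_def by metis
qed

section \<open>Compactness of the spectrum and continuity of the resolvent\<close>

locale bounded_operator =
  fixes T :: "'a::complex_banach \<Rightarrow> 'a"
  assumes bounded_linear: "bounded_linear T"
    and T_scaleC: "T (c *\<^sub>C x) = c *\<^sub>C T x"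
begin

sublocale T: bounded_linear T
  by (rule bounded_linear)

lemma bounded_linear_resolvent: "bounded_linear (\<lambda>x. \<mu> *\<^sub>C x - T x)"
  by (intro bounded_linear_sub bounded_bilinear.bounded_linear_right[OF bounded_bilinear_scaleC]
      bounded_linear)

lemmas linear_resolvent = bounded_linear.linear[OF bounded_linear_resolvent]

lemma notin_spectrum_iff:
  "\<mu> \<notin> \<sigma> T \<longleftrightarrow> bij (\<lambda>x. \<mu> *\<^sub>C x - T x) \<and> (\<exists>K>0. \<forall>x. norm x \<le> K * norm (\<mu> *\<^sub>C x - T x))"
  unfolding spectrum_on_def by (simp add: invertible_UNIV_iff)

lemma bij_imp_notin_spectrum: "bij (\<lambda>x. \<mu> *\<^sub>C x - T x) \<Longrightarrow> \<mu> \<notin> \<sigma> T"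
  unfolding spectrum_on_def
  using invertible_on_closed_subspace[OF subspace_UNIV closed_UNIV bounded_linear_resolvent] by simp

text \<open>One constant \<open>K\<close> serves all \<nu> near \<mu>; this uniformity gives
  continuity of the resolvent, beyond openness of the resolvent set.\<close>

lemma resolvent_perturb:
  assumes "\<mu> \<notin> \<sigma> T"
  obtains e K where "e > 0" "K > 0" "\<And>\<nu>. dist \<nu> \<mu> < e \<Longrightarrow> \<nu> \<notin> \<sigma> T"
    "\<And>\<nu> x. dist \<nu> \<mu> < e \<Longrightarrow> norm x \<le> K * norm (\<nu> *\<^sub>C x - T x)"
proof -
  obtain K where b: "bij (\<lambda>x. \<mu> *\<^sub>C x - T x)" and "K > 0"
    and K: "\<And>x. norm x \<le> K * norm (\<mu> *\<^sub>C x - T x)"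
    using assms unfolding notin_spectrum_iff by blast
  have *: "bij (\<lambda>x. \<nu> *\<^sub>C x - T x) \<and> (\<forall>x. norm x \<le> 2 * K * norm (\<nu> *\<^sub>C x - T x))"
    if "dist \<nu> \<mu> < 1 / (2 * K)" for \<nu>
  proof -
    have l: "linear (\<lambda>x::'a. (\<nu> - \<mu>) *\<^sub>C x)"
      using bounded_bilinear.bounded_linear_right[OF bounded_bilinear_scaleC] bounded_linear.linear by blast
    have eq: "\<mu> *\<^sub>C x - T x + (\<nu> - \<mu>) *\<^sub>C x = \<nu> *\<^sub>C x - T x" for x
      by (simp add: complex_vector.scale_left_diff_distrib)
    have d: "norm ((\<nu> - \<mu>) *\<^sub>C x) \<le> dist \<nu> \<mu> * norm x" for x :: 'a
      by (simp add: norm_scaleC dist_norm)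
    have Kd: "K * dist \<nu> \<mu> \<le> 1 / 2"
      using that \<open>K > 0\<close> by (simp add: field_simps)
    show ?thesis
      using bij_perturb[OF linear_resolvent[of \<mu>] l b K \<open>K > 0\<close> d zero_le_dist Kd]
      by (simp only: eq) simp
  qed
  show ?thesis
  proof (rule that[of "1 / (2 * K)" "2 * K"])
    show "\<nu> \<notin> \<sigma> T" if "dist \<nu> \<mu> < 1 / (2 * K)" for \<nu>
      using *[OF that] bij_imp_notin_spectrum by blast
  qed (use * \<open>K > 0\<close> in auto)
qed

lemma closed_spectrum: "closed (\<sigma> T)"
proof -
  have "\<exists>e>0. ball \<mu> e \<subseteq> - \<sigma> T" if \<mu>: "\<mu> \<in> - \<sigma> T" for \<mu>
  proof -
    obtain e where "e > 0" "\<And>\<nu>. dist \<nu> \<mu> < e \<Longrightarrow> \<nu> \<notin> \<sigma> T"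
      using resolvent_perturb[of \<mu>] \<mu> by (metis ComplD)
    then show ?thesis
      by (intro exI[of _ e]) (auto simp: dist_commute)
  qed
  then show ?thesis
    unfolding closed_def open_contains_ball by blast
qed

text \<open>For large \<mu> the operator \<open>- T\<close> is a small perturbation of the scalar
  \<mu>.\<close>

lemma bounded_spectrum: "bounded (\<sigma> T)"
proof -
  obtain B where "B > 0" and B: "\<And>x. norm (T x) \<le> norm x * B"
    using T.pos_bounded by blast
  have "\<mu> \<notin> \<sigma> T" if "norm \<mu> > 2 * B" for \<mu>
  proof (rule bij_imp_notin_spectrum)
    have "\<mu> \<noteq> 0"
      using that \<open>B > 0\<close> by auto
    have l: "linear (\<lambda>x::'a. \<mu> *\<^sub>C x)"
      using bounded_bilinear.bounded_linear_right[OF bounded_bilinear_scaleC] bounded_linear.linear by blast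
    have lT: "linear (\<lambda>x. - T x)"
      using bounded_linear.linear[OF bounded_linear_minus[OF bounded_linear]] .
    have b: "bij (\<lambda>x::'a. \<mu> *\<^sub>C x)"
      by (rule bij_betw_byWitness[of _ "\<lambda>x. (1 / \<mu>) *\<^sub>C x"]) (use \<open>\<mu> \<noteq> 0\<close> in \<open>auto simp: scaleC_scaleC\<close>)
    have K: "norm x \<le> 1 / norm \<mu> * norm (\<mu> *\<^sub>C x)" for x :: 'a
      using \<open>\<mu> \<noteq> 0\<close> by (simp add: norm_scaleC)
    have "bij (\<lambda>x. \<mu> *\<^sub>C x + - T x)"
      using that B \<open>B > 0\<close> \<open>\<mu> \<noteq> 0\<close>
      by (intro bij_perturb[OF l lT b K, of B]) (auto simp: field_simps)
    then show "bij (\<lambda>x. \<mu> *\<^sub>C x - T x)"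
      by simp
  qed
  then have "\<sigma> T \<subseteq> cball 0 (2 * B)"
    by (auto simp: not_less[symmetric])
  then show ?thesis
    using bounded_cball bounded_subset by blast
qed

lemma compact_spectrum: "compact (\<sigma> T)"
  using closed_spectrum bounded_spectrum by (simp add: compact_eq_bounded_closed)

definition resolvent :: "complex \<Rightarrow> 'a \<Rightarrow> 'a" where
  "resolvent \<mu> = inv (\<lambda>x. \<mu> *\<^sub>C x - T x)"

lemma resolvent_eq:
  assumes "\<mu> \<notin> \<sigma> T"
  shows "\<mu> *\<^sub>C resolvent \<mu> y - T (resolvent \<mu> y) = y"
  using assms unfolding notin_spectrum_iff resolvent_def
  by (metis (no_types, lifting) bij_is_surj surj_f_inv_f)

lemma continuous_on_resolvent: "continuous_on (- \<sigma> T) (\<lambda>\<mu>. resolvent \<mu> y)"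
  unfolding continuous_on_eq_continuous_at[OF closed_spectrum[unfolded closed_def]]
proof
  fix \<mu> assume "\<mu> \<in> - \<sigma> T"
  then have \<mu>: "\<mu> \<notin> \<sigma> T"
    by simp
  obtain e K where e: "e > 0" "K > 0" "\<And>\<nu>. dist \<nu> \<mu> < e \<Longrightarrow> \<nu> \<notin> \<sigma> T"
    and K: "\<And>\<nu> x. dist \<nu> \<mu> < e \<Longrightarrow> norm x \<le> K * norm (\<nu> *\<^sub>C x - T x)"
    using resolvent_perturb[OF \<mu>] by metis
  define u where "u = resolvent \<mu> y"
  have est: "norm (resolvent \<nu> y - u) \<le> K * norm u * norm (\<nu> - \<mu>)" if "dist \<nu> \<mu> < e" for \<nu>
  proof -
    have "norm (resolvent \<nu> y - u) \<le> K * norm (\<nu> *\<^sub>C (resolvent \<nu> y - u) - T (resolvent \<nu> y - u))"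
      using K[OF that] .
    \<comment> \<open>A form of the resolvent identity: both inner brackets equal \<open>y\<close>
      and cancel.\<close>
    also have "\<nu> *\<^sub>C (resolvent \<nu> y - u) - T (resolvent \<nu> y - u) =
        (\<nu> *\<^sub>C resolvent \<nu> y - T (resolvent \<nu> y)) - (\<mu> *\<^sub>C u - T u) - (\<nu> - \<mu>) *\<^sub>C u"
      by (simp add: T.diff complex_vector.scale_right_diff_distrib complex_vector.scale_left_diff_distrib)
    also have "\<dots> = - ((\<nu> - \<mu>) *\<^sub>C u)"
      unfolding u_def using resolvent_eq e(3)[OF that] \<mu> by simp
    finally show ?thesis
      by (simp add: norm_scaleC mult_ac)
  qed
  have "((\<lambda>\<nu>. K * norm u * norm (\<nu> - \<mu>)) \<longlongrightarrow> K * norm u * norm (\<mu> - \<mu>)) (at \<mu>)"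
    by (intro tendsto_intros)
  then have "((\<lambda>\<nu>. K * norm u * norm (\<nu> - \<mu>)) \<longlongrightarrow> 0) (at \<mu>)"
    by simp
  moreover have "\<forall>\<^sub>F \<nu> in at \<mu>. norm (resolvent \<nu> y - u) \<le> K * norm u * norm (\<nu> - \<mu>)"
    unfolding eventually_at using e(1) est by blast
  ultimately have "((\<lambda>\<nu>. resolvent \<nu> y - u) \<longlongrightarrow> 0) (at \<mu>)"
    by (rule Lim_null_comparison[rotated])
  then show "isCont (\<lambda>\<mu>. resolvent \<mu> y) \<mu>"
    unfolding isCont_def u_def using Lim_null by blast
qed

end

section \<open>A Cauchy formula by area integrals\<close>

text \<open>
  A real-linear map of the plane is \<open>v \<mapsto> p * v + q * cnj v\<close>, and for the derivative of \<open>\<psi>\<close> the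
  coefficient \<open>q\<close> is the Wirtinger derivative with respect to the conjugate variable.
\<close>

definition dbar :: "(complex \<Rightarrow> complex) \<Rightarrow> (complex \<Rightarrow> complex) \<Rightarrow> bool" where
  "dbar \<psi> q \<longleftrightarrow> continuous_on UNIV q \<and>
     (\<exists>p. continuous_on UNIV p \<and> (\<forall>z. (\<psi> has_derivative (\<lambda>v. p z * v + q z * cnj v)) (at z)))"

text \<open>The plane is read as pairs of reals so that the integral over a square can be iterated
  in either order.\<close>

definition square_integral :: "real \<Rightarrow> (complex \<Rightarrow> 'a::banach) \<Rightarrow> 'a" where
  "square_integral M G = integral (cbox (-M, -M) (M, M)) (\<lambda>(x, y). G (Complex x y))"

lemma continuous_on_Complex:
  assumes "continuous_on UNIV G"
  shows "continuous_on S (\<lambda>(x, y). G (Complex x y))"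
proof -
  have "continuous_on S (\<lambda>w. G (complex_of_real (fst w) + \<i> * complex_of_real (snd w)))"
    by (intro continuous_on_compose2[OF assms] continuous_intros) auto
  then show ?thesis
    by (simp add: Complex_eq case_prod_unfold)
qed

lemma integrable_on_square:
  fixes G :: "complex \<Rightarrow> 'a::banach"
  assumes "continuous_on UNIV G"
  shows "(\<lambda>(x, y). G (Complex x y)) integrable_on cbox (-M, -M) (M, M)"
  by (intro integrable_continuous continuous_on_Complex assms)

lemma square_integral_linear:
  fixes G :: "complex \<Rightarrow> 'a::banach" and L :: "'a \<Rightarrow> 'b::banach"
  assumes "continuous_on UNIV G" "bounded_linear L"
  shows "square_integral M (\<lambda>\<zeta>. L (G \<zeta>)) = L (square_integral M G)"
  using integral_linear[OF integrable_on_square[OF assms(1), of M] assms(2)]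
  by (simp add: square_integral_def o_def case_prod_unfold)

lemma square_integral_diff:
  fixes F G :: "complex \<Rightarrow> 'a::banach"
  assumes "continuous_on UNIV F" "continuous_on UNIV G"
  shows "square_integral M (\<lambda>\<zeta>. F \<zeta> - G \<zeta>) = square_integral M F - square_integral M G"
  using integral_diff[OF integrable_on_square[OF assms(1), of M] integrable_on_square[OF assms(2), of M]]
  by (simp add: square_integral_def case_prod_unfold)

lemma square_integral_partial_Re:
  fixes D :: "complex \<Rightarrow> 'a::banach"
  assumes D: "continuous_on UNIV D" and "M \<ge> 0"
    and deriv: "\<And>x y. ((\<lambda>x. \<psi> (Complex x y)) has_vector_derivative D (Complex x y)) (at x)"
    and zero: "\<And>y. \<psi> (Complex M y) = 0" "\<And>y. \<psi> (Complex (-M) y) = 0"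
  shows "square_integral M D = 0"
proof -
  have *: "integral (cbox (-M) M) (\<lambda>x. D (Complex x y)) = 0" for y
  proof -
    have "((\<lambda>x. D (Complex x y)) has_integral \<psi> (Complex M y) - \<psi> (Complex (-M) y)) {-M..M}"
      using \<open>M \<ge> 0\<close> by (intro fundamental_theorem_of_calculus has_vector_derivative_at_within[OF deriv]) auto
    then show ?thesis
      using zero by (simp add: integral_unique)
  qed
  have c: "continuous_on (cbox (-M, -M) (M, M)) (\<lambda>(x, y). D (Complex x y))"
    by (rule continuous_on_Complex[OF D])
  have "square_integral M D = integral (cbox (-M) M) (\<lambda>x. integral (cbox (-M) M) (\<lambda>y. D (Complex x y)))"
    unfolding square_integral_def using integral_prod_continuous[OF c] by simp
  \<comment> \<open>The fundamental theorem is applied along horizontal lines, so the integral over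
    \<open>x\<close> has to become the inner one.\<close>
  also have "\<dots> = integral (cbox (-M) M) (\<lambda>y. integral (cbox (-M) M) (\<lambda>x. D (Complex x y)))"
    using integral_swap_continuous[OF c] .
  finally show ?thesis
    by (simp only: * integral_0)
qed

lemma square_integral_partial_Im:
  fixes D :: "complex \<Rightarrow> 'a::banach"
  assumes D: "continuous_on UNIV D" and "M \<ge> 0"
    and deriv: "\<And>x y. ((\<lambda>y. \<psi> (Complex x y)) has_vector_derivative D (Complex x y)) (at y)"
    and zero: "\<And>x. \<psi> (Complex x M) = 0" "\<And>x. \<psi> (Complex x (-M)) = 0"
  shows "square_integral M D = 0"
proof -
  have *: "integral (cbox (-M) M) (\<lambda>y. D (Complex x y)) = 0" for x
  proof -
    have "((\<lambda>y. D (Complex x y)) has_integral \<psi> (Complex x M) - \<psi> (Complex x (-M))) {-M..M}"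
      using \<open>M \<ge> 0\<close> by (intro fundamental_theorem_of_calculus has_vector_derivative_at_within[OF deriv]) auto
    then show ?thesis
      using zero by (simp add: integral_unique)
  qed
  have "square_integral M D = integral (cbox (-M) M) (\<lambda>x. integral (cbox (-M) M) (\<lambda>y. D (Complex x y)))"
    unfolding square_integral_def using integral_prod_continuous[OF continuous_on_Complex[OF D]] by simp
  then show ?thesis
    by (simp only: * integral_0)
qed

text \<open>A case of Green's theorem. The partial derivatives of \<psi> are \<open>p + q\<close>
  and \<open>\<i> * (p - q)\<close>; each integrates to \<open>0\<close> because \<psi> vanishes on
  the boundary of the square, and \<open>2 * q\<close> is a combination of them.\<close>

lemma square_integral_dbar_eq_0:
  assumes "dbar \<psi> q" and "M > 0"
    and supp: "\<And>z. \<bar>Re z\<bar> \<ge> M \<or> \<bar>Im z\<bar> \<ge> M \<Longrightarrow> \<psi> z = 0"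
  shows "square_integral M q = 0"
proof -
  obtain p where q: "continuous_on UNIV q" and p: "continuous_on UNIV p"
    and der: "\<And>z. (\<psi> has_derivative (\<lambda>v. p z * v + q z * cnj v)) (at z)"
    using assms(1) unfolding dbar_def by blast
  have "square_integral M (\<lambda>z. p z + q z) = 0"
  proof (rule square_integral_partial_Re)
    fix x y
    have "((\<lambda>x. Complex x y) has_derivative (\<lambda>t. of_real t)) (at x)"
      unfolding Complex_eq by (auto intro!: derivative_eq_intros)
    from has_derivative_compose[OF this der]
    show "((\<lambda>x. \<psi> (Complex x y)) has_vector_derivative p (Complex x y) + q (Complex x y)) (at x)"
      unfolding has_vector_derivative_def by (simp add: scaleR_conv_of_real algebra_simps)
  qed (use p q \<open>M > 0\<close> in \<open>auto intro!: continuous_intros supp\<close>)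
  moreover have "square_integral M (\<lambda>z. \<i> * (p z - q z)) = 0"
  proof (rule square_integral_partial_Im)
    fix x y
    have "((\<lambda>y. Complex x y) has_derivative (\<lambda>t. \<i> * of_real t)) (at y)"
      unfolding Complex_eq by (auto intro!: derivative_eq_intros)
    from has_derivative_compose[OF this der]
    show "((\<lambda>y. \<psi> (Complex x y)) has_vector_derivative \<i> * (p (Complex x y) - q (Complex x y))) (at y)"
      unfolding has_vector_derivative_def by (simp add: scaleR_conv_of_real algebra_simps)
  qed (use p q \<open>M > 0\<close> in \<open>auto intro!: continuous_intros supp\<close>)
  ultimately have "square_integral M (\<lambda>z. (p z + q z) - (p z - q z)) = 0"
    using square_integral_linear[of "\<lambda>z. p z - q z" "\<lambda>w. \<i> * w" M] p q
    by (subst square_integral_diff) (auto intro!: continuous_intros bounded_linear_mult_right)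
  then show ?thesis
    using square_integral_linear[OF q bounded_linear_mult_right[of 2], of M] by simp
qed

text \<open>A real-linear map that vanishes has both coefficients \<open>0\<close>, as the
  directions \<open>1\<close> and \<open>\<i>\<close> show. This locates the support of
  \<open>q\<close> inside that of the function.\<close>

lemma dbar_unique_0:
  assumes "dbar \<psi> q" "open V" "z \<in> V" and const: "\<And>w. w \<in> V \<Longrightarrow> \<psi> w = c"
  shows "q z = 0"
    and "(\<psi> has_derivative (\<lambda>v. p * v + q z * cnj v)) (at z) \<Longrightarrow> p = 0"
proof -
  have 0: "(\<psi> has_derivative (\<lambda>v. 0)) (at z)"
    using has_derivative_transform_within_open[OF has_derivative_const[of c] assms(2,3)] const by force
  have *: "p = 0 \<and> q z = 0" if "(\<psi> has_derivative (\<lambda>v. p * v + q z * cnj v)) (at z)" for p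
  proof -
    have eq: "p * v + q z * cnj v = 0" for v
      using has_derivative_unique[OF that 0] by meson
    show ?thesis
      using eq[of 1] eq[of \<i>] by (simp add: algebra_simps)
  qed
  show "q z = 0"
    using * assms(1) unfolding dbar_def by blast
  show "(\<psi> has_derivative (\<lambda>v. p * v + q z * cnj v)) (at z) \<Longrightarrow> p = 0"
    using * by blast
qed

lemma dbar_const: "dbar (\<lambda>z. c) (\<lambda>z. 0)"
proof -
  have "((\<lambda>z. c) has_derivative (\<lambda>v. 0 * v + 0 * cnj v)) (at z)" for z :: complex
    by simp
  then show ?thesis
    unfolding dbar_def using continuous_on_const by blast
qed

lemma dbar_diff:
  assumes "dbar f u" "dbar g v"
  shows "dbar (\<lambda>z. f z - g z) (\<lambda>z. u z - v z)"
proof -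
  obtain p p' where "continuous_on UNIV p" "continuous_on UNIV p'"
    and f: "\<And>z. (f has_derivative (\<lambda>v. p z * v + u z * cnj v)) (at z)"
    and g: "\<And>z. (g has_derivative (\<lambda>w. p' z * w + v z * cnj w)) (at z)"
    using assms unfolding dbar_def by blast
  moreover have "((\<lambda>z. f z - g z) has_derivative
      (\<lambda>w. (p z - p' z) * w + (u z - v z) * cnj w)) (at z)" for z
    using has_derivative_diff[OF f g] by (simp add: algebra_simps)
  ultimately show ?thesis
    using assms unfolding dbar_def by (auto intro!: exI[of _ "\<lambda>z. p z - p' z"] continuous_intros)
qed

lemma dbar_mult:
  assumes "dbar f u" "dbar g v"
  shows "dbar (\<lambda>z. f z * g z) (\<lambda>z. u z * g z + f z * v z)"
proof -
  obtain p p' where c: "continuous_on UNIV p" "continuous_on UNIV p'" "continuous_on UNIV u" "continuous_on UNIV v"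
    and f: "\<And>z. (f has_derivative (\<lambda>v. p z * v + u z * cnj v)) (at z)"
    and g: "\<And>z. (g has_derivative (\<lambda>w. p' z * w + v z * cnj w)) (at z)"
    using assms unfolding dbar_def by blast
  have cfg: "continuous_on UNIV f" "continuous_on UNIV g"
    using f g by (meson continuous_at_imp_continuous_on has_derivative_continuous)+
  have "((\<lambda>z. f z * g z) has_derivative
      (\<lambda>w. (p z * g z + f z * p' z) * w + (u z * g z + f z * v z) * cnj w)) (at z)" for z
    using has_derivative_mult[OF f g] by (simp add: algebra_simps)
  then show ?thesis
    using c cfg unfolding dbar_def
    by (auto intro!: exI[of _ "\<lambda>z. p z * g z + f z * p' z"] continuous_intros)
qed

lemma continuous_on_extend_0:
  fixes f :: "'a::topological_space \<Rightarrow> 'b::{topological_space, zero}"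
  assumes "continuous_on U f" "open U" "closed C" "C \<subseteq> U" and "\<And>z. z \<in> U - C \<Longrightarrow> f z = 0"
  shows "continuous_on UNIV (\<lambda>z. if z \<in> U then f z else 0)"
proof -
  have "continuous_on U (\<lambda>z. if z \<in> U then f z else 0)"
    using assms(1) by (rule continuous_on_eq) simp
  moreover have "continuous_on (-C) (\<lambda>z. if z \<in> U then f z else 0)"
    by (rule continuous_on_eq[OF continuous_on_const[of _ 0]]) (use assms(5) in auto)
  ultimately have "continuous_on (U \<union> - C) (\<lambda>z. if z \<in> U then f z else 0)"
    using assms(2,3) by (intro continuous_on_open_Un) auto
  moreover have "U \<union> - C = UNIV"
    using assms(4) by blast
  ultimately show ?thesis
    by simp
qed

text \<open>A holomorphic factor contributes only to the complex-linear coefficient, so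
  \<open>q\<close> is just multiplied by \<open>h\<close>. Since \<psi> vanishes off the closed set
  \<open>C\<close>, extension by zero is harmless; \<open>h\<close> may thus be a Cauchy kernel on a
  punctured plane.\<close>

lemma dbar_mult_holomorphic:
  assumes \<psi>: "dbar \<psi> q" and U: "open U" and C: "closed C" "C \<subseteq> U"
    and supp: "\<And>z. z \<notin> C \<Longrightarrow> \<psi> z = 0" and h: "h holomorphic_on U"
  shows "dbar (\<lambda>z. if z \<in> U then \<psi> z * h z else 0) (\<lambda>z. if z \<in> U then q z * h z else 0)"
proof -
  obtain p where q: "continuous_on UNIV q" and p: "continuous_on UNIV p"
    and der: "\<And>z. (\<psi> has_derivative (\<lambda>v. p z * v + q z * cnj v)) (at z)"
    using \<psi> unfolding dbar_def by blast
  have q0: "q z = 0" if "z \<notin> C" for z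
    using dbar_unique_0(1)[OF \<psi>, of "-C" z 0] supp C that by auto
  have p0: "p z = 0" if "z \<notin> C" for z
    using dbar_unique_0(2)[OF \<psi>, of "-C" z 0 "p z"] supp C that der by auto
  have c\<psi>: "continuous_on UNIV \<psi>"
    using der by (meson continuous_at_imp_continuous_on has_derivative_continuous)
  have ch: "continuous_on U h" "continuous_on U (deriv h)"
    using h U by (auto intro!: holomorphic_on_imp_continuous_on holomorphic_deriv)
  define p' where "p' z = (if z \<in> U then p z * h z + \<psi> z * deriv h z else 0)" for z
  define q' where "q' z = (if z \<in> U then q z * h z else 0)" for z
  have "continuous_on UNIV q'"
    unfolding q'_def using q0 continuous_on_subset[OF q]
    by (intro continuous_on_extend_0[OF _ U C] continuous_intros ch) auto
  moreover have "continuous_on UNIV p'"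
    unfolding p'_def using p0 supp continuous_on_subset[OF p] continuous_on_subset[OF c\<psi>]
    by (intro continuous_on_extend_0[OF _ U C] continuous_intros ch) auto
  moreover have "((\<lambda>z. if z \<in> U then \<psi> z * h z else 0) has_derivative (\<lambda>v. p' z * v + q' z * cnj v)) (at z)" for z
  proof (cases "z \<in> U")
    case True
    then have "(h has_derivative (\<lambda>v. deriv h z * v)) (at z)"
      using holomorphic_derivI[OF h U] by (simp add: has_field_derivative_def)
    then have "((\<lambda>z. \<psi> z * h z) has_derivative (\<lambda>v. p' z * v + q' z * cnj v)) (at z)"
      using has_derivative_mult[OF der[of z], of h "\<lambda>v. deriv h z * v"] True
      by (simp add: p'_def q'_def algebra_simps)
    then show ?thesis
      by (rule has_derivative_transform_within_open[OF _ U True]) simp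
  next
    case False
    then have "z \<in> -C" "open (-C)"
      using C by auto
    then show ?thesis
      using False has_derivative_transform_within_open[OF has_derivative_const[of 0], of "-C" z "\<lambda>z. if z \<in> U then \<psi> z * h z else 0"]
        supp by (simp add: p'_def q'_def)
  qed
  ultimately show ?thesis
    unfolding dbar_def q'_def by blast
qed

section \<open>Cutoff functions\<close>

lemma has_real_derivative_max_0_sq:
  "((\<lambda>t::real. (max 0 t)\<^sup>2) has_real_derivative 2 * max 0 t) (at t)"
proof -
  consider "t > 0" | "t < 0" | "t = 0" by linarith
  then show ?thesis
  proof cases
    case 1
    have "((\<lambda>t::real. t\<^sup>2) has_real_derivative 2 * max 0 t) (at t)"
      using 1 by (auto intro!: derivative_eq_intros)
    then show ?thesis
      by (rule has_field_derivative_transform_within_open[of _ _ _ "{0<..}"]) (use 1 in auto)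
  next
    case 2
    have "((\<lambda>t::real. 0) has_real_derivative 2 * max 0 t) (at t)"
      using 2 by (auto intro!: derivative_eq_intros)
    then show ?thesis
      by (rule has_field_derivative_transform_within_open[of _ _ _ "{..<0}"]) (use 2 in auto)
  next
    case 3
    have "((\<lambda>y. (max 0 y)\<^sup>2 / y) \<longlongrightarrow> 0) (at (0::real))"
    proof (rule Lim_null_comparison)
      show "\<forall>\<^sub>F y in at 0. norm ((max 0 y)\<^sup>2 / y) \<le> \<bar>y::real\<bar>"
        by (intro always_eventually) (auto simp: max_def power2_eq_square)
      show "((\<lambda>y. \<bar>y::real\<bar>) \<longlongrightarrow> 0) (at 0)"
        using tendsto_rabs[OF tendsto_ident_at[of "0::real"]] by simp
    qed
    then show ?thesis
      using 3 by (simp add: has_field_derivative_iff)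
  qed
qed

text \<open>Continuous first derivatives suffice for \<open>dbar\<close>, so squares of positive
  parts do the job of the usual exponentials. The strict sign at \<open>1 / 2\<close> later makes
  the constant of the Cauchy formula nonzero.\<close>

lemma smooth_step:
  obtains s s' :: "real \<Rightarrow> real"
  where "\<And>t. (s has_real_derivative s' t) (at t)" "continuous_on UNIV s'" "\<And>t. s' t \<le> 0"
    and "s' (1 / 2) < 0" "\<And>t. t \<le> 0 \<Longrightarrow> s t = 1" "\<And>t. t \<ge> 1 \<Longrightarrow> s t = 0"
proof
  define u v where "u t = (max 0 (1 - t))\<^sup>2" and "v t = (max 0 t)\<^sup>2" for t :: real
  define u' v' where "u' t = - 2 * max 0 (1 - t)" and "v' t = 2 * max 0 t" for t :: real
  define s s' where "s t = u t / (u t + v t)"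
    and "s' t = (u' t * v t - u t * v' t) / (u t + v t)\<^sup>2" for t
  have pos: "u t + v t > 0" for t
    by (cases "t > 0") (auto simp: u_def v_def intro!: add_pos_nonneg add_nonneg_pos)
  have u: "(u has_real_derivative u' t) (at t)" for t
  proof -
    have "((\<lambda>t. 1 - t) has_real_derivative -1) (at t)"
      by (auto intro!: derivative_eq_intros)
    from DERIV_chain2[OF has_real_derivative_max_0_sq this] show ?thesis
      by (simp add: u_def[abs_def] u'_def)
  qed
  have v: "(v has_real_derivative v' t) (at t)" for t
    unfolding v_def[abs_def] v'_def by (rule has_real_derivative_max_0_sq)
  show "(s has_real_derivative s' t) (at t)" for t
    unfolding s_def[abs_def] s'_def
    by (rule DERIV_cong[OF DERIV_divide[OF u DERIV_add[OF u v]]])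
      (use pos[of t] in \<open>auto simp: power2_eq_square algebra_simps\<close>)
  have "(u t + v t)\<^sup>2 \<noteq> 0" for t
    using pos[of t] by simp
  then show "continuous_on UNIV s'"
    unfolding s'_def u_def v_def u'_def v'_def by (intro continuous_intros) auto
  have "u' t * v t \<le> 0" "u t * v' t \<ge> 0" for t
    by (auto simp: u_def v_def u'_def v'_def mult_nonpos_nonneg)
  then show "s' t \<le> 0" for t
    unfolding s'_def by (intro divide_nonpos_nonneg) (smt (verit), simp)
  show "s' (1 / 2) < 0"
    by (simp add: s'_def u_def v_def u'_def v'_def power2_eq_square)
  show "s t = 1" if "t \<le> 0" for t
    using pos[of t] that by (auto simp: s_def v_def max_def)
  show "s t = 0" if "t \<ge> 1" for t
    using that by (simp add: s_def u_def)
qed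

text \<open>For a radial function the conjugate derivative is a real multiple of
  \<open>z - a\<close>. Dividing it by \<open>z - a\<close> therefore leaves a real function
  \<open>g\<close> of constant sign, whose integral can be seen to be nonzero without being
  computed.\<close>

lemma disc_bump:
  assumes "r > 0"
  obtains b g z0 where "dbar b (\<lambda>z. of_real (g z) * (z - a))" "continuous_on UNIV g" "\<And>z. g z \<le> 0"
    "g z0 < 0" "\<And>z. dist z a \<le> r \<Longrightarrow> b z = 1" "\<And>z. dist z a \<ge> 2 * r \<Longrightarrow> b z = 0"
proof -
  obtain s s' :: "real \<Rightarrow> real" where
    s: "\<And>t. (s has_real_derivative s' t) (at t)" and s': "continuous_on UNIV s'" "\<And>t. s' t \<le> 0"
      "s' (1 / 2) < 0" and s1: "\<And>t. t \<le> 0 \<Longrightarrow> s t = 1" and s0: "\<And>t. t \<ge> 1 \<Longrightarrow> s t = 0"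
    using smooth_step by metis
  \<comment> \<open>Normalised to be \<open>0\<close> on the circle of radius \<open>r\<close> and
    \<open>1\<close> on the circle of radius \<open>2 * r\<close>.\<close>
  define T where "T z = ((norm (z - a))\<^sup>2 / r\<^sup>2 - 1) / 3" for z
  define b where "b z = complex_of_real (s (T z))" for z
  define g where "g z = s' (T z) / (3 * r\<^sup>2)" for z
  have T: "(T has_derivative (\<lambda>v. 2 * inner (z - a) v / (3 * r\<^sup>2))) (at z)" for z
    unfolding T_def power2_norm_eq_inner using \<open>r > 0\<close>
    by (auto intro!: derivative_eq_intros simp: inner_commute field_simps)
  have "continuous_on UNIV T"
    using T by (meson continuous_at_imp_continuous_on has_derivative_continuous)
  then have cg: "continuous_on UNIV g"
    unfolding g_def using \<open>r > 0\<close>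
    by (intro continuous_intros continuous_on_compose2[OF s'(1)]) auto
  have "(b has_derivative (\<lambda>v. of_real (g z) * cnj (z - a) * v + of_real (g z) * (z - a) * cnj v)) (at z)" for z
  proof -
    have "(s has_derivative (\<lambda>x. s' (T z) * x)) (at (T z))"
      using s has_field_derivative_def by blast
    from has_derivative_of_real[OF has_derivative_compose[OF T this]]
    have "(b has_derivative (\<lambda>v. of_real (s' (T z) * (2 * inner (z - a) v / (3 * r\<^sup>2))))) (at z)"
      unfolding b_def[abs_def] .
    moreover have "complex_of_real (s' (T z) * (2 * inner (z - a) v / (3 * r\<^sup>2))) =
        of_real (g z) * cnj (z - a) * v + of_real (g z) * (z - a) * cnj v" for v
    proof -
      have "complex_of_real (s' (T z) * (2 * inner (z - a) v / (3 * r\<^sup>2))) =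
          of_real (g z) * of_real (2 * inner (z - a) v)"
        by (simp add: g_def)
      also have "complex_of_real (2 * inner (z - a) v) = cnj (z - a) * v + (z - a) * cnj v"
        by (simp add: complex_eq_iff inner_complex_def algebra_simps)
      finally show ?thesis
        by (simp add: distrib_left mult.assoc)
    qed
    ultimately show ?thesis
      by simp
  qed
  moreover have "continuous_on UNIV (\<lambda>z. of_real (g z) * cnj (z - a))"
    "continuous_on UNIV (\<lambda>z. of_real (g z) * (z - a))"
    using cg by (intro continuous_intros; simp)+
  ultimately have "dbar b (\<lambda>z. of_real (g z) * (z - a))"
    unfolding dbar_def by (intro conjI exI[of _ "\<lambda>z. of_real (g z) * cnj (z - a)"]) auto
  moreover have "g z \<le> 0" for z
    unfolding g_def using s'(2) by (intro divide_nonpos_nonneg) auto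
  \<comment> \<open>At radius \<open>r * sqrt (5 / 2)\<close> the value of \<open>T\<close> is the
    \<open>1 / 2\<close> at which the step function strictly decreases.\<close>
  moreover have "T (a + of_real (r * sqrt (5 / 2))) = 1 / 2"
    using \<open>r > 0\<close> by (simp add: T_def norm_mult power_mult_distrib)
  then have "g (a + of_real (r * sqrt (5 / 2))) < 0"
    unfolding g_def using s'(3) \<open>r > 0\<close> by (simp only:) (simp add: divide_neg_pos)
  moreover have "b z = 1" if "dist z a \<le> r" for z
  proof -
    have "(norm (z - a))\<^sup>2 \<le> r\<^sup>2"
      using that by (auto simp: dist_norm intro: power_mono)
    then show ?thesis
      using \<open>r > 0\<close> by (simp add: b_def T_def s1)
  qed
  moreover have "b z = 0" if "dist z a \<ge> 2 * r" for z
  proof -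
    have "(2 * r)\<^sup>2 \<le> (norm (z - a))\<^sup>2"
      using that \<open>r > 0\<close> by (intro power_mono) (auto simp: dist_norm)
    then show ?thesis
      using \<open>r > 0\<close> by (simp add: b_def T_def s0 field_simps)
  qed
  ultimately show ?thesis
    using that cg by blast
qed

text \<open>Finitely many disc bumps are combined as one minus the product of the
  \<open>1 - b\<close>: the result is \<open>1\<close> wherever some bump is \<open>1\<close>, and
  \<open>0\<close> wherever all bumps vanish.\<close>

lemma cutoff_function:
  assumes K: "compact K" and U: "open U" "K \<subseteq> U"
  obtains \<eta> q C V where "dbar \<eta> q" "compact C" "C \<subseteq> U" "\<And>z. z \<notin> C \<Longrightarrow> \<eta> z = 0"
    "open V" "K \<subseteq> V" "\<And>z. z \<in> V \<Longrightarrow> \<eta> z = 1"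
proof -
  have "\<exists>r>0. cball a (2 * r) \<subseteq> U" if "a \<in> K" for a
  proof -
    obtain e where "e > 0" "cball a e \<subseteq> U"
      using U \<open>a \<in> K\<close> open_contains_cball by blast
    then show ?thesis
      by (intro exI[of _ "e / 2"]) auto
  qed
  then obtain r where r: "\<And>a. a \<in> K \<Longrightarrow> r a > 0" "\<And>a. a \<in> K \<Longrightarrow> cball a (2 * r a) \<subseteq> U"
    by metis
  have "\<exists>\<eta> q C. dbar \<eta> q \<and> compact C \<and> C \<subseteq> U \<and> (\<forall>z. z \<notin> C \<longrightarrow> \<eta> z = 0) \<and>
      (\<forall>z\<in>(\<Union>a\<in>F. ball a (r a)). \<eta> z = 1)" if "finite F" "F \<subseteq> K" for F
    using that
  proof (induction F rule: finite_induct)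
    case empty
    show ?case
      by (rule exI[of _ "\<lambda>_. 0"], rule exI[of _ "\<lambda>_. 0"], rule exI[of _ "{}"]) (auto intro: dbar_const)
  next
    case (insert a F)
    then have "F \<subseteq> K"
      by simp
    from insert.IH[OF this] obtain \<eta> q C where \<eta>: "dbar \<eta> q" "compact C" "C \<subseteq> U"
      "\<And>z. z \<notin> C \<Longrightarrow> \<eta> z = 0" "\<And>z. z \<in> (\<Union>a\<in>F. ball a (r a)) \<Longrightarrow> \<eta> z = 1"
      by metis
    have a: "a \<in> K" "r a > 0"
      using insert r by auto
    obtain b g z0 where b: "dbar b (\<lambda>z. of_real (g z) * (z - a))"
        "\<And>z. dist z a \<le> r a \<Longrightarrow> b z = 1" "\<And>z. dist z a \<ge> 2 * r a \<Longrightarrow> b z = 0"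
      using disc_bump[OF a(2)] by metis
    define \<psi> where "\<psi> z = 1 - (1 - \<eta> z) * (1 - b z)" for z
    obtain q' where "dbar \<psi> q'"
      using dbar_diff[OF dbar_const[of 1] dbar_mult[OF dbar_diff[OF dbar_const[of 1] \<eta>(1)]
          dbar_diff[OF dbar_const[of 1] b(1)]]] unfolding \<psi>_def[abs_def] by blast
    moreover have "compact (C \<union> cball a (2 * r a))" "C \<union> cball a (2 * r a) \<subseteq> U"
      using \<eta> a r by auto
    moreover have "\<psi> z = 0" if "z \<notin> C \<union> cball a (2 * r a)" for z
      using that \<eta>(4) b(3) by (auto simp: \<psi>_def dist_commute)
    moreover have "\<psi> z = 1" if "z \<in> (\<Union>a\<in>insert a F. ball a (r a))" for z
      using that \<eta>(5)[of z] b(2)[of z] by (auto simp: \<psi>_def dist_commute)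
    ultimately show ?case
      by blast
  qed
  moreover obtain F where "F \<subseteq> K" "finite F" "K \<subseteq> (\<Union>a\<in>F. ball a (r a))"
  proof -
    have "K \<subseteq> (\<Union>a\<in>K. ball a (r a))"
      using r(1) by auto
    from compactE_image[OF K _ this] show thesis
      using that by (metis open_ball)
  qed
  ultimately obtain \<eta> q C where "dbar \<eta> q" "compact C" "C \<subseteq> U" "\<And>z. z \<notin> C \<Longrightarrow> \<eta> z = 0"
      "\<And>z. z \<in> (\<Union>a\<in>F. ball a (r a)) \<Longrightarrow> \<eta> z = 1"
    by metis
  then show ?thesis
    using that[of \<eta> q C "\<Union>a\<in>F. ball a (r a)"] \<open>K \<subseteq> (\<Union>a\<in>F. ball a (r a))\<close> by (meson open_UN open_ball)
qed

text \<open>The Cauchy-Pompeiu formula for a cutoff \<eta> times \<open>h\<close>. Because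
  \<open>q\<close> vanishes near \<open>K\<close>, the kernel \<open>1 / (z - w)\<close> causes no
  singularity. The constant is not evaluated; comparing \<eta> with a bump around \<open>w\<close>
  shows that it is nonzero.\<close>

lemma cutoff_cauchy_formula:
  assumes K: "compact K" and U: "open U" "K \<subseteq> U"
  obtains q M C V where "continuous_on UNIV q" "compact C" "C \<subseteq> U" "open V" "K \<subseteq> V"
    "\<And>z. z \<in> V \<Longrightarrow> q z = 0" "\<And>z. z \<notin> C \<Longrightarrow> q z = 0"
    "\<And>w. w \<in> K \<Longrightarrow> \<exists>c. c \<noteq> 0 \<and> (\<forall>h. h holomorphic_on U \<longrightarrow>
        square_integral M (\<lambda>z. q z * h z / (z - w)) = c * h w)"
proof -
  obtain \<eta> q C V where \<eta>: "dbar \<eta> q" and C: "compact C" "C \<subseteq> U" and \<eta>0: "\<And>z. z \<notin> C \<Longrightarrow> \<eta> z = 0"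
    and V: "open V" "K \<subseteq> V" and \<eta>1: "\<And>z. z \<in> V \<Longrightarrow> \<eta> z = 1"
    using cutoff_function[OF assms] by metis
  have clC: "closed C"
    using C compact_imp_closed by blast
  have cq: "continuous_on UNIV q"
    using \<eta> unfolding dbar_def by blast
  have qV: "q z = 0" if "z \<in> V" for z
    using dbar_unique_0(1)[OF \<eta> V(1) that] \<eta>1 by blast
  have qC: "q z = 0" if "z \<notin> C" for z
    using dbar_unique_0(1)[OF \<eta>, of "-C" z 0] clC \<eta>0 that by auto
  have VC: "V \<subseteq> C"
    using \<eta>0 \<eta>1 by force
  obtain M where "M > 0" and M: "\<And>z. z \<in> C \<Longrightarrow> norm z < M"
    using compact_imp_bounded[OF C(1)] unfolding bounded_pos_less by metis
  have out: "z \<notin> C" if "\<bar>Re z\<bar> \<ge> M \<or> \<bar>Im z\<bar> \<ge> M" for z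
    using that M[of z] abs_Re_le_cmod[of z] abs_Im_le_cmod[of z] by linarith
  have "\<exists>c. c \<noteq> 0 \<and> (\<forall>h. h holomorphic_on U \<longrightarrow>
        square_integral M (\<lambda>z. q z * h z / (z - w)) = c * h w)" if "w \<in> K" for w
  proof -
    define c where "c = square_integral M (\<lambda>z. q z / (z - w))"
    have w: "w \<in> V" "w \<in> U" "q w = 0"
      using that V U qV by auto
    \<comment> \<open>Near \<open>w\<close> the numerator vanishes, and at \<open>w\<close> itself
      division by zero returns the value \<open>0\<close> that continuity requires.\<close>
    have "continuous_on UNIV (\<lambda>z. if z \<in> -{w} then q z / (z - w) else 0)"
      using continuous_on_subset[OF cq] V qV w
      by (intro continuous_on_extend_0[of _ _ "-V"] continuous_intros) auto
    moreover have "(\<lambda>z. if z \<in> -{w} then q z / (z - w) else 0) = (\<lambda>z. q z / (z - w))"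
      by auto
    ultimately have cont: "continuous_on UNIV (\<lambda>z. q z / (z - w))"
      by (simp only:)
    obtain r where "r > 0" and r: "cball w (2 * r) \<subseteq> V"
    proof -
      obtain e where "e > 0" "cball w e \<subseteq> V"
        using V(1) w(1) open_contains_cball by blast
      then show thesis
        using that[of "e / 2"] by auto
    qed
    obtain b g z0 where b: "dbar b (\<lambda>z. of_real (g z) * (z - w))" and g: "continuous_on UNIV g"
      "\<And>z. g z \<le> 0" "g z0 < 0" and b1: "\<And>z. dist z w \<le> r \<Longrightarrow> b z = 1"
      and b0: "\<And>z. dist z w \<ge> 2 * r \<Longrightarrow> b z = 0"
      by (rule disc_bump[OF \<open>r > 0\<close>, of w]) (rule that; assumption)
    have b0': "b z = 0" if "z \<notin> V" for z
      using that r b0[of z] by (force simp: dist_commute)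
    have g0: "g z = 0" if "z \<notin> V" for z
    proof -
      have "z \<in> -cball w (2 * r)" "open (-cball w (2 * r))"
        using that r by auto
      then have "of_real (g z) * (z - w) = 0"
        using dbar_unique_0(1)[OF b, of "-cball w (2 * r)" z 0] b0 by (auto simp: dist_commute)
      then show ?thesis
        using that w by auto
    qed
    \<comment> \<open>Both \<eta> and \<open>b\<close> equal \<open>1\<close> near \<open>w\<close>,
      so their difference divided by \<open>z - w\<close> is a compactly supported function without
      a pole. Hence \<eta> and \<open>b\<close> yield the same constant.\<close>
    have "square_integral M (\<lambda>z. if z \<in> -{w} then (q z - of_real (g z) * (z - w)) * (1 / (z - w)) else 0) = 0"
    proof (rule square_integral_dbar_eq_0[OF dbar_mult_holomorphic[OF dbar_diff[OF \<eta> b]]])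
      show "closed (- ball w r)" "- ball w r \<subseteq> - {w}"
        using \<open>r > 0\<close> by auto
      show "\<eta> z - b z = 0" if "z \<notin> - ball w r" for z
      proof -
        have "dist z w \<le> r" "z \<in> V"
          using that r \<open>r > 0\<close> by (auto simp: dist_commute)
        then show ?thesis
          by (simp add: \<eta>1 b1)
      qed
      show "(\<lambda>z. 1 / (z - w)) holomorphic_on - {w}"
        by (intro holomorphic_intros) auto
      show "(if z \<in> - {w} then (\<eta> z - b z) * (1 / (z - w)) else 0) = 0"
        if "M \<le> \<bar>Re z\<bar> \<or> M \<le> \<bar>Im z\<bar>" for z
        using out[OF that] VC b0'[of z] \<eta>0[of z] by auto
    qed (use \<open>M > 0\<close> in auto)
    also have "(\<lambda>z. if z \<in> -{w} then (q z - of_real (g z) * (z - w)) * (1 / (z - w)) else 0) =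
        (\<lambda>z. q z / (z - w) - of_real (if z = w then 0 else g z))"
      by (auto simp: fun_eq_iff diff_divide_distrib)
    also have "(\<lambda>z. if z = w then 0 else g z) = g"
    proof -
      \<comment> \<open>Near \<open>w\<close> the bump is constant, which gives
        \<open>g z * (z - w) = 0\<close> and so \<open>g z = 0\<close> only for \<open>z\<close>
        different from \<open>w\<close>; continuity supplies the value at \<open>w\<close>.\<close>
      have "g w = 0"
      proof (rule ccontr)
        assume "g w \<noteq> 0"
        then have "open (g -` (-{0}))"
          using g(1) by (intro open_vimage) (auto simp: continuous_on_eq_continuous_within)
        then obtain e where "e > 0" and e: "\<And>z. dist w z < e \<Longrightarrow> g z \<noteq> 0"
          using \<open>g w \<noteq> 0\<close> unfolding open_contains_ball by (force simp: subset_eq)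
        define z where "z = w + of_real (min e r / 2)"
        have z: "dist w z < e" "z \<in> ball w r" "z \<noteq> w"
          using \<open>e > 0\<close> \<open>r > 0\<close> by (auto simp: z_def dist_norm)
        have "of_real (g z) * (z - w) = 0"
          by (rule dbar_unique_0(1)[OF b, of "ball w r" z 1]) (use z b1 in \<open>auto simp: dist_commute\<close>)
        then show False
          using z e by simp
      qed
      then show ?thesis
        by auto
    qed
    also have "square_integral M (\<lambda>z. q z / (z - w) - complex_of_real (g z)) =
        c - of_real (square_integral M g)"
      using square_integral_linear[OF g(1) bounded_linear_of_real[where 'a = complex], of M] g(1)
      by (subst square_integral_diff) (auto simp: c_def cont intro!: continuous_intros)
    finally have c_eq: "c = of_real (square_integral M g)"
      by simp
    \<comment> \<open>\<open>- g\<close> is continuous, nonnegative and positive at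
      \<open>z0\<close>, and \<open>z0\<close> lies in the square because \<open>g\<close> vanishes
      off \<open>V\<close>.\<close>
    have "square_integral M g \<noteq> 0"
    proof
      assume "square_integral M g = 0"
      have cg: "continuous_on (cbox (-M, -M) (M, M)) (\<lambda>(x, y). - g (Complex x y))"
        by (intro continuous_on_Complex continuous_intros g)
      have "integral (cbox (-M, -M) (M, M)) (\<lambda>(x, y). - g (Complex x y)) = 0"
        using \<open>square_integral M g = 0\<close> square_integral_linear[OF g(1) bounded_linear_minus[OF bounded_linear_ident], of M]
        by (simp add: square_integral_def)
      then have "\<forall>w\<in>cbox (-M, -M) (M, M). (\<lambda>(x, y). - g (Complex x y)) w = 0"
        by (subst (asm) integral_cbox_eq_0_iff[OF cg])
          (use g(2) \<open>M > 0\<close> in \<open>auto simp: box_ne_empty Basis_prod_def\<close>)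
      moreover have "z0 \<in> C"
        using g(3) g0[of z0] VC by auto
      then have "(Re z0, Im z0) \<in> cbox (-M, -M) (M, M)"
        using M[of z0] abs_Re_le_cmod[of z0] abs_Im_le_cmod[of z0] by (auto simp: cbox_Pair_eq)
      ultimately have "- g (Complex (Re z0) (Im z0)) = 0"
        by (metis (mono_tags, lifting) case_prod_conv)
      then show False
        using g(3) by simp
    qed
    then have "c \<noteq> 0"
      by (simp add: c_eq)
    moreover have "square_integral M (\<lambda>z. q z * h z / (z - w)) = c * h w" if h: "h holomorphic_on U" for h
    proof -
      \<comment> \<open>The difference quotient is holomorphic across \<open>w\<close>, so the
        integral of \<open>q * H\<close> vanishes; expanding \<open>H\<close> transfers the constant
        from \<open>1\<close> to \<open>h\<close>.\<close>
      define H where "H z = (if z = w then deriv h w else (h z - h w) / (z - w))" for z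
      have H: "H holomorphic_on U"
        unfolding H_def using pole_lemma[OF h, of w] w U by (simp add: interior_open)
      have "continuous_on UNIV (\<lambda>z. if z \<in> U then q z / (z - w) * h z else 0)"
        using C qC
        by (intro continuous_on_extend_0[OF _ U(1) clC] continuous_on_mult
            continuous_on_subset[OF cont] holomorphic_on_imp_continuous_on[OF h]) auto
      moreover have eq: "(\<lambda>z. if z \<in> U then q z / (z - w) * h z else 0) = (\<lambda>z. q z * h z / (z - w))"
        by (rule ext) (use qC C in auto)
      ultimately have ch: "continuous_on UNIV (\<lambda>z. q z * h z / (z - w))"
        by (simp only:)
      have "square_integral M (\<lambda>z. if z \<in> U then q z * H z else 0) = 0"
        using out \<eta>0
        by (intro square_integral_dbar_eq_0[OF dbar_mult_holomorphic[OF \<eta> U(1) clC C(2) \<eta>0 H] \<open>M > 0\<close>]) auto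
      moreover have "(\<lambda>z. if z \<in> U then q z * H z else 0) = (\<lambda>z. q z * h z / (z - w) - h w * (q z / (z - w)))"
        by (rule ext) (use qC C w in \<open>auto simp: H_def diff_divide_distrib algebra_simps\<close>)
      ultimately show ?thesis
        using square_integral_linear[OF cont bounded_linear_mult_right[of "h w"], of M]
          square_integral_diff[OF ch continuous_on_mult_left[OF cont, of "h w"], of M]
        by (simp add: c_def mult.commute)
    qed
    ultimately show ?thesis
      by blast
  qed
  then show ?thesis
    using that cq C V qV qC by blast
qed

section \<open>Orbits near an interior fixed point\<close>

text \<open>Excluding rotations makes the Schwarz inequalities strict. On the closed disc through
  \<open>z\<close> the quotient \<open>\<psi> w / w\<close> attains its maximal modulus, which is
  below \<open>1\<close>, and so contracts the orbit geometrically.\<close>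

lemma Schwarz_contraction:
  assumes hol: "\<psi> holomorphic_on \<D>" and "\<psi> 0 = 0" and self: "\<And>z. norm z < 1 \<Longrightarrow> norm (\<psi> z) < 1"
    and not_rot: "\<nexists>a. (\<forall>z. norm z < 1 \<longrightarrow> \<psi> z = a * z) \<and> norm a = 1"
  shows "norm (deriv \<psi> 0) < 1" and "norm z < 1 \<Longrightarrow> (\<lambda>n. (\<psi> ^^ n) z) \<longlonglongrightarrow> 0"
proof -
  note Schwarz = Schwarz_Lemma[OF hol \<open>\<psi> 0 = 0\<close> self]
  show d: "norm (deriv \<psi> 0) < 1"
    using Schwarz(2)[of 0] Schwarz(3)[of 0] not_rot by fastforce
  have less: "norm (\<psi> z) < norm z" if "norm z < 1" "z \<noteq> 0" for z
    using Schwarz(1)[of z] Schwarz(3)[of 0] not_rot that by fastforce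
  show "(\<lambda>n. (\<psi> ^^ n) z) \<longlonglongrightarrow> 0" if z: "norm z < 1"
  proof -
    define s where "s = norm z"
    define q where "q w = (if w = 0 then deriv \<psi> 0 else (\<psi> w - \<psi> 0) / (w - 0))" for w
    have "q holomorphic_on \<D>"
      unfolding q_def using pole_lemma[OF hol, of 0] by (simp add: interior_open)
    then have "continuous_on (cball 0 s) (\<lambda>w. norm (q w))"
      using z by (intro continuous_on_norm holomorphic_on_imp_continuous_on)
        (auto simp: s_def elim: holomorphic_on_subset)
    moreover have "cball (0::complex) s \<noteq> {}"
      by (simp add: s_def)
    ultimately obtain w0 where w0: "w0 \<in> cball 0 s" "\<And>w. w \<in> cball 0 s \<Longrightarrow> norm (q w) \<le> norm (q w0)"
      using continuous_attains_sup[of "cball 0 s" "\<lambda>w. norm (q w)"] by auto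
    define k where "k = norm (q w0)"
    have "norm w0 < 1"
      using w0(1) z by (simp add: s_def)
    then have "k < 1"
      using d less[of w0] \<open>\<psi> 0 = 0\<close> by (auto simp: k_def q_def norm_divide)
    have step: "norm (\<psi> w) \<le> k * norm w" if "norm w \<le> s" for w
    proof (cases "w = 0")
      case False
      then have "norm (\<psi> w) = norm (q w) * norm w"
        using \<open>\<psi> 0 = 0\<close> by (simp add: q_def norm_divide)
      also have "\<dots> \<le> k * norm w"
        unfolding k_def using w0(2)[of w] that by (intro mult_right_mono) auto
      finally show ?thesis .
    qed (use \<open>\<psi> 0 = 0\<close> in simp)
    have "norm ((\<psi> ^^ n) z) \<le> k ^ n * s" for n
    proof (induction n)
      case (Suc n)
      have "k \<ge> 0"
        by (simp add: k_def)
      have "k ^ n * s \<le> s"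
        using \<open>k \<ge> 0\<close> \<open>k < 1\<close> by (simp add: s_def mult_left_le_one_le power_le_one)
      then have "norm (\<psi> ((\<psi> ^^ n) z)) \<le> k * norm ((\<psi> ^^ n) z)"
        using Suc by (intro step) auto
      also have "\<dots> \<le> k * (k ^ n * s)"
        using Suc \<open>k \<ge> 0\<close> by (rule mult_left_mono)
      finally show ?case
        by simp
    qed (simp add: s_def)
    moreover have "(\<lambda>n. k ^ n * s) \<longlonglongrightarrow> 0"
      using \<open>k < 1\<close> by (intro tendsto_mult_left_zero LIMSEQ_power_zero) (simp add: k_def)
    ultimately show ?thesis
      by (intro Lim_null_comparison[of "\<lambda>n. (\<psi> ^^ n) z"]) auto
  qed
qed

text \<open>A disc automorphism moves \<alpha> to \<open>0\<close>, which reduces the claim to the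
  Schwarz lemma. The derivative at a fixed point does not change under conjugation.\<close>

lemma interior_fixed_point:
  assumes hol: "\<phi> holomorphic_on \<D>" and self: "\<phi> ` \<D> \<subseteq> \<D>" and not_aut: "\<not> disc_automorphism \<phi>"
    and \<alpha>: "\<alpha> \<in> \<D>" "\<phi> \<alpha> = \<alpha>"
  shows "norm (deriv \<phi> \<alpha>) < 1" and "z \<in> \<D> \<Longrightarrow> (\<lambda>n. (\<phi> ^^ n) z) \<longlonglongrightarrow> \<alpha>"
proof -
  obtain f g where f: "f \<alpha> = 0" "f holomorphic_on \<D>" "f ` \<D> \<subseteq> \<D>"
    and g: "g holomorphic_on \<D>" "g ` \<D> \<subseteq> \<D>"
    and fg: "\<And>z. z \<in> \<D> \<Longrightarrow> f (g z) = z" and gf: "\<And>z. z \<in> \<D> \<Longrightarrow> g (f z) = z"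
    using ball_biholomorphism_exists[OF \<alpha>(1)] by blast
  have in_D: "f z \<in> \<D>" "g z \<in> \<D>" "\<phi> z \<in> \<D>" if "z \<in> \<D>" for z
    using that f g self by blast+
  have "g 0 = \<alpha>"
    using gf[OF \<alpha>(1)] f(1) by simp
  define \<psi> where "\<psi> = (\<lambda>z. f (\<phi> (g z)))"
  have hol\<psi>: "\<psi> holomorphic_on \<D>"
    unfolding \<psi>_def
    using holomorphic_on_compose_gen[OF holomorphic_on_compose_gen[OF g(1) hol g(2)] f(2)] self g(2)
    by (auto simp: o_def)
  have \<psi>0: "\<psi> 0 = 0"
    by (simp add: \<psi>_def \<open>g 0 = \<alpha>\<close> \<alpha> f)
  have self\<psi>: "norm (\<psi> z) < 1" if "norm z < 1" for z
    using in_D[of "\<phi> (g z)"] in_D[of "g z"] in_D[of z] that by (auto simp: \<psi>_def)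
  have not_rot: "\<nexists>a. (\<forall>z. norm z < 1 \<longrightarrow> \<psi> z = a * z) \<and> norm a = 1"
  proof
    assume "\<exists>a. (\<forall>z. norm z < 1 \<longrightarrow> \<psi> z = a * z) \<and> norm a = 1"
    then obtain a where a: "\<And>z. z \<in> \<D> \<Longrightarrow> \<psi> z = a * z" and "norm a = 1"
      by auto
    \<comment> \<open>If \<psi> is the rotation by \<open>a\<close>, then \<phi> is \<open>f\<close>
      followed by this rotation and \<open>g\<close>, and \<open>h\<close> reverses the three
      maps.\<close>
    define h where "h = (\<lambda>z. g (f z / a))"
    have "a \<noteq> 0"
      using \<open>norm a = 1\<close> by auto
    have fa: "f z / a \<in> \<D>" if "z \<in> \<D>" for z
      using in_D(1)[OF that] \<open>norm a = 1\<close> by (simp add: norm_divide)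
    have "h holomorphic_on \<D>"
    proof -
      have "(\<lambda>z. f z / a) holomorphic_on \<D>"
        using f(2) \<open>a \<noteq> 0\<close> by (intro holomorphic_intros) auto
      moreover have "(\<lambda>z. f z / a) ` \<D> \<subseteq> \<D>"
        using fa by blast
      ultimately show ?thesis
        using holomorphic_on_compose_gen[OF _ g(1)] by (simp add: h_def o_def)
    qed
    moreover have "h ` \<D> \<subseteq> \<D>"
      using fa in_D(2) by (auto simp: h_def)
    moreover have "h (\<phi> z) = z" if "z \<in> \<D>" for z
    proof -
      have "f (\<phi> z) = \<psi> (f z)"
        by (simp add: \<psi>_def gf[OF that])
      then show ?thesis
        using a[OF in_D(1)[OF that]] gf[OF that] \<open>a \<noteq> 0\<close> by (simp add: h_def)
    qed
    moreover have "\<phi> (h z) = z" if "z \<in> \<D>" for z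
    proof -
      have "\<phi> (h z) = g (\<psi> (f z / a))"
        unfolding h_def \<psi>_def using gf[OF in_D(3)[OF in_D(2)[OF fa[OF that]]]] by simp
      also have "\<dots> = z"
        using a[OF fa[OF that]] gf[OF that] \<open>a \<noteq> 0\<close> by simp
      finally show ?thesis .
    qed
    ultimately show False
      using not_aut hol self unfolding disc_automorphism_def by blast
  qed
  have \<phi>_eq: "\<phi> z = g (\<psi> (f z))" if "z \<in> \<D>" for z
    unfolding \<psi>_def using gf in_D that by simp
  have "deriv \<phi> \<alpha> = deriv \<psi> 0"
  proof -
    have df: "(f has_field_derivative deriv f \<alpha>) (at \<alpha>)"
      using f(2) \<alpha>(1) by (intro holomorphic_derivI) auto
    have dg: "(g has_field_derivative deriv g 0) (at 0)"
      using g(1) by (intro holomorphic_derivI) auto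
    have d\<psi>: "(\<psi> has_field_derivative deriv \<psi> 0) (at 0)"
      using hol\<psi> by (intro holomorphic_derivI) auto
    have "((\<lambda>z. g (f z)) has_field_derivative deriv g 0 * deriv f \<alpha>) (at \<alpha>)"
      using DERIV_chain2[of g _ f \<alpha>] df dg f(1) by simp
    then have "((\<lambda>z. z) has_field_derivative deriv g 0 * deriv f \<alpha>) (at \<alpha>)"
      by (rule has_field_derivative_transform_within_open[of _ _ _ \<D>]) (use \<alpha> gf in auto)
    then have 1: "deriv g 0 * deriv f \<alpha> = 1"
      using DERIV_ident DERIV_unique by blast
    have "((\<lambda>z. \<psi> (f z)) has_field_derivative deriv \<psi> 0 * deriv f \<alpha>) (at \<alpha>)"
      using DERIV_chain2[of \<psi> _ f \<alpha>] df d\<psi> f(1) by simp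
    then have "((\<lambda>z. g (\<psi> (f z))) has_field_derivative deriv g 0 * (deriv \<psi> 0 * deriv f \<alpha>)) (at \<alpha>)"
      using DERIV_chain2[of g _ "\<lambda>z. \<psi> (f z)" \<alpha>] dg f(1) \<psi>0 by simp
    then have "(\<phi> has_field_derivative deriv g 0 * (deriv \<psi> 0 * deriv f \<alpha>)) (at \<alpha>)"
      by (rule has_field_derivative_transform_within_open[of _ _ _ \<D>]) (use \<alpha> \<phi>_eq in auto)
    then show ?thesis
      using DERIV_imp_deriv 1 by (metis mult.assoc mult.commute mult_1)
  qed
  then show "norm (deriv \<phi> \<alpha>) < 1"
    using Schwarz_contraction(1)[OF hol\<psi> \<psi>0 self\<psi> not_rot] by simp
  show "(\<lambda>n. (\<phi> ^^ n) z) \<longlonglongrightarrow> \<alpha>" if z: "z \<in> \<D>"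
  proof -
    have "(\<psi> ^^ n) (f z) \<in> \<D> \<and> (\<phi> ^^ n) z = g ((\<psi> ^^ n) (f z))" for n
    proof (induction n)
      case (Suc n)
      then show ?case
        using \<phi>_eq[of "g ((\<psi> ^^ n) (f z))"] fg in_D self\<psi> by simp
    qed (use z gf in_D in auto)
    then have "(\<lambda>n. (\<phi> ^^ n) z) = (\<lambda>n. g ((\<psi> ^^ n) (f z)))"
      by blast
    moreover have "(\<lambda>n. (\<psi> ^^ n) (f z)) \<longlonglongrightarrow> 0"
      using in_D(1)[OF z] by (intro Schwarz_contraction(2)[OF hol\<psi> \<psi>0 self\<psi> not_rot]) auto
    moreover have "isCont g 0"
      using g(1) by (metis centre_in_ball continuous_on_eq_continuous_at holomorphic_on_imp_continuous_on open_ball zero_less_one)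
    ultimately show ?thesis
      using isCont_tendsto_compose \<open>g 0 = \<alpha>\<close> by fastforce
  qed
qed

text \<open>Any \<kappa> strictly between the modulus of the multiplier and \<open>1\<close> is a
  contraction factor near \<alpha>, and every orbit enters that neighbourhood. Only \<open>C\<close>
  depends on the point, so one \<kappa> governs all orbits.\<close>

lemma geometric_convergence_to_fixed_point:
  assumes hol: "\<phi> holomorphic_on \<D>" and self: "\<phi> ` \<D> \<subseteq> \<D>" and not_aut: "\<not> disc_automorphism \<phi>"
    and \<alpha>: "\<alpha> \<in> \<D>" "\<phi> \<alpha> = \<alpha>"
  obtains \<kappa> where "0 < \<kappa>" "\<kappa> < 1"
    "\<And>z. z \<in> \<D> \<Longrightarrow> \<exists>C. \<forall>n. norm ((\<phi> ^^ n) z - \<alpha>) \<le> C * \<kappa> ^ n"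
proof -
  define \<kappa> where "\<kappa> = (1 + norm (deriv \<phi> \<alpha>)) / 2"
  have \<kappa>: "0 < \<kappa>" "\<kappa> < 1" "norm (deriv \<phi> \<alpha>) < \<kappa>"
    using interior_fixed_point(1)[OF assms] by (auto simp: \<kappa>_def intro: add_pos_nonneg)
  have "(\<phi> has_field_derivative deriv \<phi> \<alpha>) (at \<alpha>)"
    using hol \<alpha>(1) by (intro holomorphic_derivI) auto
  then have "((\<lambda>z. norm ((\<phi> z - \<alpha>) / (z - \<alpha>))) \<longlongrightarrow> norm (deriv \<phi> \<alpha>)) (at \<alpha>)"
    using \<alpha>(2) by (intro tendsto_norm) (simp add: has_field_derivative_iff)
  then have "\<forall>\<^sub>F z in at \<alpha>. norm ((\<phi> z - \<alpha>) / (z - \<alpha>)) < \<kappa>"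
    using order_tendstoD(2) \<kappa>(3) by blast
  then obtain r where "r > 0" and r: "\<And>z. z \<noteq> \<alpha> \<Longrightarrow> dist z \<alpha> < r \<Longrightarrow> norm ((\<phi> z - \<alpha>) / (z - \<alpha>)) < \<kappa>"
    unfolding eventually_at by blast
  have step: "norm (\<phi> z - \<alpha>) \<le> \<kappa> * norm (z - \<alpha>)" if "norm (z - \<alpha>) < r" for z
    using r[of z] that \<alpha>(2) \<kappa>(1) by (cases "z = \<alpha>") (auto simp: dist_norm norm_divide divide_simps)
  have iter: "norm ((\<phi> ^^ n) z - \<alpha>) \<le> norm (z - \<alpha>) * \<kappa> ^ n" if z: "norm (z - \<alpha>) < r" for z n
  proof (induction n)
    case (Suc n)
    have "norm (z - \<alpha>) * \<kappa> ^ n \<le> norm (z - \<alpha>)"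
      using \<kappa> by (intro mult_left_le) (auto simp: power_le_one)
    then have "norm (\<phi> ((\<phi> ^^ n) z) - \<alpha>) \<le> \<kappa> * norm ((\<phi> ^^ n) z - \<alpha>)"
      using Suc z by (intro step) linarith
    also have "\<dots> \<le> \<kappa> * (norm (z - \<alpha>) * \<kappa> ^ n)"
      using Suc \<kappa> by (intro mult_left_mono) auto
    finally show ?case
      by (simp add: mult_ac)
  qed simp
  have "\<exists>C. \<forall>n. norm ((\<phi> ^^ n) z - \<alpha>) \<le> C * \<kappa> ^ n" if z: "z \<in> \<D>" for z
  proof -
    obtain n0 where n0: "norm ((\<phi> ^^ n0) z - \<alpha>) < r"
      using interior_fixed_point(2)[OF assms z] \<open>r > 0\<close> unfolding LIMSEQ_iff by blast
    \<comment> \<open>A sum that dominates each of the finitely many ratios before the orbit comes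
      near \<alpha>, and the ratio at \<open>n0\<close> itself.\<close>
    define C where "C = (\<Sum>i\<le>n0. norm ((\<phi> ^^ i) z - \<alpha>) / \<kappa> ^ i)"
    have C: "norm ((\<phi> ^^ i) z - \<alpha>) / \<kappa> ^ i \<le> C" if "i \<le> n0" for i
      unfolding C_def using that \<kappa> by (intro member_le_sum) auto
    have "norm ((\<phi> ^^ n) z - \<alpha>) \<le> C * \<kappa> ^ n" for n
    proof (cases "n \<le> n0")
      case True
      then show ?thesis
        using C[of n] \<kappa> by (simp add: divide_simps)
    next
      case False
      define m where "m = n - n0"
      have n: "n = m + n0"
        using False by (simp add: m_def)
      have "norm ((\<phi> ^^ n) z - \<alpha>) \<le> norm ((\<phi> ^^ n0) z - \<alpha>) * \<kappa> ^ m"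
        unfolding n funpow_add o_apply by (rule iter[OF n0])
      also have "\<dots> \<le> (C * \<kappa> ^ n0) * \<kappa> ^ m"
        using C[of n0] \<kappa> by (intro mult_right_mono) (auto simp: divide_simps)
      finally show ?thesis
        by (simp add: n power_add mult_ac)
    qed
    then show ?thesis
      by blast
  qed
  then show ?thesis
    using that \<kappa> by blast
qed

section \<open>Composition operators\<close>

text \<open>Compare Taylor series at \<alpha>: the series \<open>Q\<close> of
  \<open>\<phi> - \<alpha>\<close> has no constant term, so only terms of index up to
  \<open>k\<close> reach degree \<open>k\<close>. Those below \<open>k\<close> vanish by assumption,
  and \<open>Q ^ k\<close> starts with \<open>deriv \<phi> \<alpha> ^ k\<close>.\<close>

lemma higher_deriv_compose_fixed_point:
  assumes f: "f holomorphic_on A" and \<phi>: "\<phi> holomorphic_on A" and A: "open A" "\<alpha> \<in> A" and self: "\<phi> ` A \<subseteq> A"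
    and fp: "\<phi> \<alpha> = \<alpha>" and zero: "\<And>j. j < k \<Longrightarrow> (deriv ^^ j) f \<alpha> = 0"
  shows "(deriv ^^ k) (f \<circ> \<phi>) \<alpha> = deriv \<phi> \<alpha> ^ k * (deriv ^^ k) f \<alpha>"
proof -
  have an: "f analytic_on {\<alpha>}" "\<phi> analytic_on {\<alpha>}" "(f \<circ> \<phi>) analytic_on {\<alpha>}"
    using f \<phi> holomorphic_on_compose_gen[OF \<phi> f self] A analytic_at by blast+
  define Q where "Q = fps_expansion \<phi> \<alpha> - fps_const \<alpha>"
  have Q: "(\<lambda>x. \<phi> (\<alpha> + x) - \<alpha>) has_fps_expansion Q"
    unfolding Q_def using analytic_at_imp_has_fps_expansion[OF an(2)] by (intro fps_expansion_intros)
  have Q0: "fps_nth Q 0 = 0" and Q1: "fps_nth Q 1 = deriv \<phi> \<alpha>"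
    by (simp_all add: Q_def fps_expansion_def fp)
  have "((\<lambda>x. f (\<alpha> + x)) \<circ> (\<lambda>x. \<phi> (\<alpha> + x) - \<alpha>)) has_fps_expansion (fps_expansion f \<alpha> oo Q)"
    by (rule has_fps_expansion_compose[OF analytic_at_imp_has_fps_expansion[OF an(1)] Q Q0])
  then have "(\<lambda>x. (f \<circ> \<phi>) (\<alpha> + x)) has_fps_expansion (fps_expansion f \<alpha> oo Q)"
    by (simp add: o_def)
  then have "fps_expansion (f \<circ> \<phi>) \<alpha> = fps_expansion f \<alpha> oo Q"
    using analytic_at_imp_has_fps_expansion[OF an(3)] fps_expansion_unique_complex by blast
  then have "(deriv ^^ k) (f \<circ> \<phi>) \<alpha> / fact k = fps_nth (fps_expansion f \<alpha> oo Q) k"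
    by (metis fps_expansion_def fps_nth_Abs_fps)
  also have "\<dots> = (\<Sum>i=0..k. (deriv ^^ i) f \<alpha> / fact i * fps_nth (Q ^ i) k)"
    by (simp add: fps_compose_nth fps_expansion_def)
  also have "\<dots> = (\<Sum>i\<in>{k}. (deriv ^^ i) f \<alpha> / fact i * fps_nth (Q ^ i) k)"
    by (rule sum.mono_neutral_right) (use zero in auto)
  also have "\<dots> = (deriv ^^ k) f \<alpha> / fact k * deriv \<phi> \<alpha> ^ k"
    using startsby_zero_power_nth_same[OF Q0, of k] Q1 by simp
  finally show ?thesis
    by (simp add: field_simps)
qed

text \<open>The dynamics of \<phi> enters through the multiplier bound and the orbit rate \<kappa>;
  both are established beforehand from \<phi> not being an automorphism.\<close>

locale composition_operator =
  fixes \<phi> :: "complex \<Rightarrow> complex" and \<alpha> :: complex and \<iota> :: "'a::complex_banach \<Rightarrow> complex \<Rightarrow> complex"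
    and T :: "'a \<Rightarrow> 'a" and \<kappa> :: real
  assumes hol: "\<phi> holomorphic_on \<D>" and self: "\<phi> ` \<D> \<subseteq> \<D>"
    and \<alpha>: "\<alpha> \<in> \<D>" "\<phi> \<alpha> = \<alpha>"
    and deriv_nz: "deriv \<phi> \<alpha> \<noteq> 0" and deriv_lt_1: "norm (deriv \<phi> \<alpha>) < 1"
    and embed: "continuously_embedded_in_Hol \<iota>"
    and \<iota>_T: "z \<in> \<D> \<Longrightarrow> \<iota> (T x) z = \<iota> x (\<phi> z)"
    and \<kappa>: "0 < \<kappa>" "\<kappa> < 1"
    and orbit: "z \<in> \<D> \<Longrightarrow> \<exists>C. \<forall>n. norm ((\<phi> ^^ n) z - \<alpha>) \<le> C * \<kappa> ^ n"
begin

lemma \<iota>_hol: "\<iota> x holomorphic_on \<D>"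
  and \<iota>_add: "z \<in> \<D> \<Longrightarrow> \<iota> (x + y) z = \<iota> x z + \<iota> y z"
  and \<iota>_scaleC: "z \<in> \<D> \<Longrightarrow> \<iota> (c *\<^sub>C x) z = c * \<iota> x z"
  and \<iota>_eqI: "(\<And>z. z \<in> \<D> \<Longrightarrow> \<iota> x z = \<iota> y z) \<Longrightarrow> x = y"
  and \<iota>_continuous: "compact K \<Longrightarrow> K \<subseteq> \<D> \<Longrightarrow> uniform_limit K \<iota> (\<iota> x) (at x)"
  using embed unfolding continuously_embedded_in_Hol_def
  by (elim conjE; simp)+

lemma \<iota>_scaleR: "z \<in> \<D> \<Longrightarrow> \<iota> (r *\<^sub>R x) z = of_real r * \<iota> x z"
  by (simp add: scaleR_scaleC \<iota>_scaleC)

lemma \<iota>_0: "z \<in> \<D> \<Longrightarrow> \<iota> 0 z = 0"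
  using \<iota>_scaleR[of z 0 0] by simp

lemma \<iota>_diff: "z \<in> \<D> \<Longrightarrow> \<iota> (x - y) z = \<iota> x z - \<iota> y z"
  using \<iota>_add[of z "x - y" y] by simp

text \<open>Continuity at \<open>0\<close> and homogeneity turn uniform convergence on
  \<open>K\<close> into a seminorm estimate.\<close>

lemma \<iota>_bounded:
  assumes "compact K" "K \<subseteq> \<D>"
  obtains M where "M > 0" "\<And>x z. z \<in> K \<Longrightarrow> norm (\<iota> x z) \<le> M * norm x"
proof -
  have "\<forall>\<^sub>F x in at 0. \<forall>z\<in>K. dist (\<iota> x z) (\<iota> 0 z) < 1"
    using \<iota>_continuous[OF assms, of 0] by (rule uniform_limitD) simp
  then obtain d where "d > 0" and d: "\<And>x z. x \<noteq> 0 \<Longrightarrow> norm x < d \<Longrightarrow> z \<in> K \<Longrightarrow> norm (\<iota> x z) < 1"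
    unfolding eventually_at using assms(2) by (auto simp: \<iota>_0 subset_eq)
  have "norm (\<iota> x z) \<le> 2 / d * norm x" if "z \<in> K" for x z
  proof (cases "x = 0")
    case True
    then show ?thesis
      using \<iota>_0 that assms(2) by auto
  next
    case False
    define t where "t = d / (2 * norm x)"
    have "t > 0"
      using False \<open>d > 0\<close> by (simp add: t_def)
    have "norm (\<iota> (t *\<^sub>R x) z) < 1"
      using False \<open>d > 0\<close> by (intro d that) (auto simp: t_def)
    then have "t * norm (\<iota> x z) < 1"
      using \<iota>_scaleR[of z t x] that assms(2) \<open>t > 0\<close> by (auto simp: norm_mult)
    then show ?thesis
      using False \<open>d > 0\<close> by (simp add: t_def field_simps)
  qed
  then show ?thesis
    using that[of "2 / d"] \<open>d > 0\<close> by simp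
qed

lemma bounded_linear_\<iota>:
  assumes "z \<in> \<D>"
  shows "bounded_linear (\<lambda>x. \<iota> x z)"
proof -
  obtain M where "\<And>x. norm (\<iota> x z) \<le> M * norm x"
    using \<iota>_bounded[of "{z}"] assms by (metis compact_sing empty_subsetI insert_subset singletonI)
  then show ?thesis
    using assms by (intro bounded_linear_intro[of _ M]) (auto simp: \<iota>_add \<iota>_scaleR scaleR_conv_of_real mult.commute)
qed

lemma \<phi>_in_disc: "z \<in> \<D> \<Longrightarrow> \<phi> z \<in> \<D>"
  using self by blast

lemma orbit_in_disc: "z \<in> \<D> \<Longrightarrow> (\<phi> ^^ n) z \<in> \<D>"
  by (induction n) (auto dest: \<phi>_in_disc simp del: mem_ball mem_ball_0)

lemma \<iota>_funpow: "z \<in> \<D> \<Longrightarrow> \<iota> ((T ^^ n) x) z = \<iota> x ((\<phi> ^^ n) z)"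
  by (induction n arbitrary: z) (simp_all add: \<iota>_T \<phi>_in_disc funpow_swap1[of \<phi>] del: mem_ball mem_ball_0)

lemma T_add: "T (x + y) = T x + T y"
  by (rule \<iota>_eqI) (simp add: \<iota>_T \<iota>_add \<phi>_in_disc del: mem_ball mem_ball_0)

lemma T_scaleC': "T (c *\<^sub>C x) = c *\<^sub>C T x"
  by (rule \<iota>_eqI) (simp add: \<iota>_T \<iota>_scaleC \<phi>_in_disc del: mem_ball mem_ball_0)

text \<open>Point evaluations are continuous and separate elements, so the graph of \<open>T\<close>
  is closed.\<close>

sublocale bounded_operator T
proof (rule bounded_operator.intro)
  obtain K where "\<And>x. norm (T x) \<le> K * norm x"
  proof (rule closed_graph_bounded[OF subspace_UNIV closed_UNIV, of T])
    show "T (x + y) = T x + T y" "T (c *\<^sub>R x) = c *\<^sub>R T x" for x y c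
      by (simp_all only: T_add scaleR_scaleC T_scaleC')
    show thesis if *: "\<And>x. x \<in> UNIV \<Longrightarrow> norm (T x) \<le> K * norm x" for K
      by (rule \<open>\<And>K. (\<And>x. norm (T x) \<le> K * norm x) \<Longrightarrow> thesis\<close>) (rule *[OF UNIV_I])
    fix u x y assume "u \<longlonglongrightarrow> x" "(\<lambda>n. T (u n)) \<longlonglongrightarrow> y"
    show "y = T x"
    proof (rule \<iota>_eqI)
      fix z assume z: "z \<in> \<D>"
      have "(\<lambda>n. \<iota> (u n) (\<phi> z)) \<longlonglongrightarrow> \<iota> y z"
        using bounded_linear.tendsto[OF bounded_linear_\<iota>[OF z] \<open>(\<lambda>n. T (u n)) \<longlonglongrightarrow> y\<close>]
        by (simp only: \<iota>_T[OF z])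
      moreover have "(\<lambda>n. \<iota> (u n) (\<phi> z)) \<longlonglongrightarrow> \<iota> x (\<phi> z)"
        using bounded_linear.tendsto[OF bounded_linear_\<iota>[OF \<phi>_in_disc[OF z]]] \<open>u \<longlonglongrightarrow> x\<close> .
      ultimately show "\<iota> y z = \<iota> (T x) z"
        unfolding \<iota>_T[OF z] by (rule LIMSEQ_unique)
    qed
  qed
  then show "bounded_linear T"
    by (intro bounded_linear_intro[of _ K]) (simp_all add: T_add scaleR_scaleC T_scaleC' mult.commute)
qed (rule T_scaleC')

section \<open>Taylor coefficients at the fixed point and the filtration by vanishing order\<close>

definition coeff :: "nat \<Rightarrow> 'a \<Rightarrow> complex" where
  "coeff k x = (deriv ^^ k) (\<iota> x) \<alpha> / fact k"

text \<open>The identities for \<open>\<iota>\<close> hold on the disc only; derivatives at \<alpha>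
  depend on the germ there, so this is enough.\<close>

lemma coeff_cong:
  assumes "\<And>z. z \<in> \<D> \<Longrightarrow> \<iota> x z = f z"
  shows "coeff k x = (deriv ^^ k) f \<alpha> / fact k"
proof -
  have "\<forall>\<^sub>F z in nhds \<alpha>. \<iota> x z = f z"
    using eventually_nhds_in_open[of \<D> \<alpha>] \<alpha>(1) assms by (auto elim!: eventually_mono)
  then show ?thesis
    unfolding coeff_def by (simp add: higher_deriv_cong_ev)
qed

lemma coeff_add: "coeff k (x + y) = coeff k x + coeff k y"
  using coeff_cong[of "x + y" "\<lambda>z. \<iota> x z + \<iota> y z" k] higher_deriv_add[OF \<iota>_hol \<iota>_hol open_ball \<alpha>(1), of k x y]
  by (simp add: \<iota>_add coeff_def add_divide_distrib)

lemma coeff_scaleC: "coeff k (c *\<^sub>C x) = c * coeff k x"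
  using coeff_cong[of "c *\<^sub>C x" "\<lambda>z. c * \<iota> x z" k] higher_deriv_cmult[OF \<iota>_hol \<alpha>(1) open_ball, of k c x]
  by (simp add: \<iota>_scaleC coeff_def)

text \<open>Cauchy estimates on one fixed circle. That \<open>M\<close> and \<open>R\<close> do not
  depend on \<open>k\<close> allows Taylor tails to be summed.\<close>

lemma coeff_bounded:
  obtains M R where "M > 0" "R > 0" "cball \<alpha> R \<subseteq> \<D>" "\<And>k x. norm (coeff k x) \<le> M * norm x / R ^ k"
proof -
  obtain R where R: "R > 0" "cball \<alpha> R \<subseteq> \<D>"
    using \<alpha>(1) open_contains_cball[of \<D>] open_ball by meson
  obtain M where "M > 0" and M: "\<And>x z. z \<in> cball \<alpha> R \<Longrightarrow> norm (\<iota> x z) \<le> M * norm x"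
    using \<iota>_bounded[OF compact_cball R(2)] by metis
  have "norm (coeff k x) \<le> M * norm x / R ^ k" for k x
  proof -
    have "norm ((deriv ^^ k) (\<iota> x) \<alpha>) \<le> fact k * (M * norm x) / R ^ k"
    proof (rule Cauchy_inequality)
      have "\<iota> x holomorphic_on cball \<alpha> R"
        using \<iota>_hol R(2) by (rule holomorphic_on_subset)
      then show "\<iota> x holomorphic_on ball \<alpha> R" "continuous_on (cball \<alpha> R) (\<iota> x)"
        by (auto intro: holomorphic_on_subset holomorphic_on_imp_continuous_on)
      show "norm (\<iota> x z) \<le> M * norm x" if "norm (\<alpha> - z) = R" for z
        using that by (intro M) (simp add: dist_norm)
    qed (use R in auto)
    then show ?thesis
      by (simp add: coeff_def norm_divide field_simps)
  qed
  then show ?thesis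
    using that R \<open>M > 0\<close> by blast
qed

lemma bounded_linear_coeff: "bounded_linear (coeff k)"
proof -
  obtain M R where "M > 0" "R > 0" and "\<And>k x. norm (coeff k x) \<le> M * norm x / R ^ k"
    using coeff_bounded by metis
  then show ?thesis
    by (intro bounded_linear_intro[of _ "M / R ^ k"])
      (auto simp: coeff_add coeff_scaleC scaleR_scaleC scaleR_conv_of_real mult.commute)
qed

lemma coeff_diff: "coeff k (x - y) = coeff k x - coeff k y"
  using coeff_add[of k "x - y" y] by simp

text \<open>A decreasing filtration in which each step is the kernel of one functional, hence has
  codimension at most one.\<close>

definition vanishing :: "nat \<Rightarrow> 'a set" where
  "vanishing N = {x. \<forall>k<N. coeff k x = 0}"

lemma vanishing_0: "vanishing 0 = UNIV"
  by (simp add: vanishing_def)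

lemma vanishing_Suc_iff: "x \<in> vanishing (Suc k) \<longleftrightarrow> x \<in> vanishing k \<and> coeff k x = 0"
  by (auto simp: vanishing_def less_Suc_eq)

lemma vanishing_mono: "x \<in> vanishing n \<Longrightarrow> k \<le> n \<Longrightarrow> x \<in> vanishing k"
  by (auto simp: vanishing_def)

lemma subspace_vanishing: "complex_vector.subspace (vanishing N)"
proof (rule complex_vector.subspaceI)
  show "0 \<in> vanishing N"
    using coeff_scaleC[of _ 0 0] by (simp add: vanishing_def)
qed (auto simp: vanishing_def coeff_add coeff_scaleC)

lemma closed_vanishing: "closed (vanishing N)"
proof -
  have "vanishing N = (\<Inter>k<N. coeff k -` {0})"
    by (auto simp: vanishing_def)
  then show ?thesis
    by (auto intro!: closed_vimage linear_continuous_on bounded_linear_coeff)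
qed

text \<open>Thus \<open>T\<close> acts on \<open>vanishing k\<close> modulo
  \<open>vanishing (Suc k)\<close> as the scalar \<open>deriv \<phi> \<alpha> ^ k\<close>.\<close>

lemma coeff_T:
  assumes "x \<in> vanishing k"
  shows "coeff k (T x) = deriv \<phi> \<alpha> ^ k * coeff k x"
proof -
  have "(deriv ^^ k) (\<iota> x \<circ> \<phi>) \<alpha> = deriv \<phi> \<alpha> ^ k * (deriv ^^ k) (\<iota> x) \<alpha>"
    using assms by (intro higher_deriv_compose_fixed_point[OF \<iota>_hol hol open_ball \<alpha>(1) self \<alpha>(2)])
      (auto simp: vanishing_def coeff_def)
  moreover have "coeff k (T x) = (deriv ^^ k) (\<iota> x \<circ> \<phi>) \<alpha> / fact k"
    by (rule coeff_cong) (simp add: \<iota>_T)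
  ultimately show ?thesis
    by (simp add: coeff_def)
qed

lemma T_vanishing: "x \<in> vanishing k \<Longrightarrow> T x \<in> vanishing k"
proof -
  assume x: "x \<in> vanishing k"
  have "coeff j (T x) = 0" if "j < k" for j
    using coeff_T[of x j] vanishing_mono[OF x, of j] x that by (simp add: vanishing_def)
  then show "T x \<in> vanishing k"
    by (simp add: vanishing_def)
qed

text \<open>As the multiplier is nonzero, \<open>T\<close> preserves the lowest nonvanishing order.
  This keeps preimages under \<open>T\<close> in the filtration.\<close>

lemma vanishing_T_imp: "T x \<in> vanishing k \<Longrightarrow> x \<in> vanishing k"
proof (induction k)
  case (Suc k)
  then have x: "x \<in> vanishing k"
    by (simp add: vanishing_Suc_iff)
  then show ?case
    using Suc.prems coeff_T[OF x] deriv_nz by (simp add: vanishing_Suc_iff)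
qed (simp add: vanishing_0)

text \<open>The Taylor series starts at degree \<open>N\<close>. Staying within half the radius
  \<open>R\<close> of the Cauchy estimates leaves a tail of ratio \<open>1 / 2\<close>, whence the
  factor \<open>2\<close>.\<close>

lemma vanishing_bound_near:
  obtains C r where "C \<ge> 0" "r > 0"
    "\<And>x w. x \<in> vanishing N \<Longrightarrow> dist \<alpha> w < r \<Longrightarrow> norm (\<iota> x w) \<le> C * norm x * norm (w - \<alpha>) ^ N"
proof -
  obtain M R where "M > 0" "R > 0" and R: "cball \<alpha> R \<subseteq> \<D>"
    and M: "\<And>k x. norm (coeff k x) \<le> M * norm x / R ^ k"
    using coeff_bounded by metis
  have "norm (\<iota> x w) \<le> (2 * M / R ^ N) * norm x * norm (w - \<alpha>) ^ N"
    if x: "x \<in> vanishing N" and w: "dist \<alpha> w < R / 2" for x w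
  proof -
    have hb: "\<iota> x holomorphic_on ball \<alpha> R"
      using \<iota>_hol R by (meson ball_subset_cball holomorphic_on_subset order_trans)
    have "w \<in> ball \<alpha> R"
      using w \<open>R > 0\<close> by simp
    then have "(\<lambda>n. coeff n x * (w - \<alpha>) ^ n) sums \<iota> x w"
      unfolding coeff_def by (rule holomorphic_power_series[OF hb])
    moreover have "(\<Sum>n<N. coeff n x * (w - \<alpha>) ^ n) = 0"
      using x by (simp add: vanishing_def)
    ultimately have sums: "(\<lambda>n. coeff (n + N) x * (w - \<alpha>) ^ (n + N)) sums \<iota> x w"
      using sums_split_initial_segment[of _ _ N] by fastforce
    define B where "B = M * norm x / R ^ N * norm (w - \<alpha>) ^ N"
    have bound: "norm (coeff (n + N) x * (w - \<alpha>) ^ (n + N)) \<le> B * (1 / 2) ^ n" for n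
    proof -
      have "norm (w - \<alpha>) / R \<le> 1 / 2"
        using w \<open>R > 0\<close> by (simp add: dist_norm norm_minus_commute field_simps)
      then have "(norm (w - \<alpha>) / R) ^ n \<le> (1 / 2) ^ n"
        using \<open>R > 0\<close> by (intro power_mono) auto
      have "norm (coeff (n + N) x * (w - \<alpha>) ^ (n + N)) \<le> M * norm x / R ^ (n + N) * norm (w - \<alpha>) ^ (n + N)"
        unfolding norm_mult norm_power using M by (intro mult_right_mono) auto
      also have "\<dots> = B * (norm (w - \<alpha>) / R) ^ n"
        by (simp add: B_def power_add power_divide mult_ac)
      also have "\<dots> \<le> B * (1 / 2) ^ n"
        using \<open>(norm (w - \<alpha>) / R) ^ n \<le> (1 / 2) ^ n\<close> \<open>M > 0\<close> \<open>R > 0\<close>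
        by (intro mult_left_mono) (auto simp: B_def)
      finally show ?thesis .
    qed
    have "norm (\<iota> x w) \<le> (\<Sum>n. B * (1 / 2) ^ n)"
      unfolding sums_unique[OF sums]
      by (rule norm_suminf_le) (auto intro!: bound summable_mult summable_geometric)
    also have "\<dots> = 2 * B"
      by (subst suminf_mult) (auto simp: suminf_geometric)
    finally show ?thesis
      by (simp add: B_def mult_ac)
  qed
  then show ?thesis
    using that[of "2 * M / R ^ N" "R / 2"] \<open>M > 0\<close> \<open>R > 0\<close> by simp
qed

text \<open>At distance at least \<open>r\<close> from \<alpha> the plain bound on \<open>K\<close>
  suffices, at the cost of a factor \<open>1 / r ^ N\<close>.\<close>

lemma vanishing_bound:
  assumes "compact K" "K \<subseteq> \<D>"
  obtains C where "C \<ge> 0"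
    "\<And>x w. x \<in> vanishing N \<Longrightarrow> w \<in> K \<Longrightarrow> norm (\<iota> x w) \<le> C * norm x * norm (w - \<alpha>) ^ N"
proof -
  obtain C r where C: "C \<ge> 0" "r > 0"
    "\<And>x w. x \<in> vanishing N \<Longrightarrow> dist \<alpha> w < r \<Longrightarrow> norm (\<iota> x w) \<le> C * norm x * norm (w - \<alpha>) ^ N"
    by (rule vanishing_bound_near[of N]) (rule that; assumption)
  obtain M where "M > 0" and M: "\<And>x z. z \<in> K \<Longrightarrow> norm (\<iota> x z) \<le> M * norm x"
    using \<iota>_bounded[OF assms] by metis
  have "norm (\<iota> x w) \<le> (C + M / r ^ N) * norm x * norm (w - \<alpha>) ^ N"
    if x: "x \<in> vanishing N" and w: "w \<in> K" for x w
  proof (cases "dist \<alpha> w < r")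
    case True
    have "norm (\<iota> x w) \<le> C * norm x * norm (w - \<alpha>) ^ N"
      using C(3)[OF x True] .
    also have "\<dots> \<le> (C + M / r ^ N) * norm x * norm (w - \<alpha>) ^ N"
      using \<open>M > 0\<close> C(2) by (intro mult_right_mono) auto
    finally show ?thesis .
  next
    case False
    have "norm (\<iota> x w) \<le> M / r ^ N * norm x * r ^ N"
      using M[OF w] C(2) by simp
    also have "\<dots> \<le> M / r ^ N * norm x * norm (w - \<alpha>) ^ N"
      using False C(2) \<open>M > 0\<close> by (intro mult_left_mono power_mono) (auto simp: dist_norm norm_minus_commute)
    also have "\<dots> \<le> (C + M / r ^ N) * norm x * norm (w - \<alpha>) ^ N"
      using C(1) by (intro mult_right_mono) auto
    finally show ?thesis .
  qed
  then show ?thesis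
    using that[of "C + M / r ^ N"] C \<open>M > 0\<close> by simp
qed

text \<open>The orbit together with its limit \<alpha> is compact, so a zero of order
  \<open>N\<close> turns the rate \<kappa> into \<open>\<kappa> ^ N\<close>. The constant is uniform
  in \<open>x\<close>, which matters when \<open>x\<close> is later varied along with
  \<open>n\<close>.\<close>

lemma orbit_decay:
  assumes z: "z \<in> \<D>"
  obtains C where "C \<ge> 0" "\<And>x n. x \<in> vanishing N \<Longrightarrow> norm (\<iota> x ((\<phi> ^^ n) z)) \<le> C * norm x * (\<kappa> ^ N) ^ n"
proof -
  obtain C1 where C1: "\<And>n. norm ((\<phi> ^^ n) z - \<alpha>) \<le> C1 * \<kappa> ^ n"
    using orbit[OF z] by blast
  have "C1 \<ge> 0"
    using order_trans[OF norm_ge_zero C1[of 0]] by simp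
  have "(\<lambda>n. C1 * \<kappa> ^ n) \<longlonglongrightarrow> 0"
    using \<kappa> by (intro tendsto_mult_right_zero LIMSEQ_power_zero) auto
  then have "(\<lambda>n. (\<phi> ^^ n) z - \<alpha>) \<longlonglongrightarrow> 0"
    by (rule Lim_null_comparison[rotated]) (use C1 in auto)
  then have lim: "(\<lambda>n. (\<phi> ^^ n) z) \<longlonglongrightarrow> \<alpha>"
    using Lim_null by blast
  define K where "K = insert \<alpha> (range (\<lambda>n. (\<phi> ^^ n) z))"
  have "compact K" "K \<subseteq> \<D>"
    unfolding K_def using compact_sequence_with_limit[OF lim] \<alpha>(1) orbit_in_disc[OF z] by auto
  then obtain C where "C \<ge> 0"
    and C: "\<And>x w. x \<in> vanishing N \<Longrightarrow> w \<in> K \<Longrightarrow> norm (\<iota> x w) \<le> C * norm x * norm (w - \<alpha>) ^ N"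
    using vanishing_bound by metis
  have "norm (\<iota> x ((\<phi> ^^ n) z)) \<le> (C * C1 ^ N) * norm x * (\<kappa> ^ N) ^ n" if x: "x \<in> vanishing N" for x n
  proof -
    have "norm (\<iota> x ((\<phi> ^^ n) z)) \<le> C * norm x * norm ((\<phi> ^^ n) z - \<alpha>) ^ N"
      using C[OF x] by (simp add: K_def)
    also have "\<dots> \<le> C * norm x * (C1 * \<kappa> ^ n) ^ N"
      using C1 \<open>C \<ge> 0\<close> by (intro mult_left_mono power_mono) auto
    finally show ?thesis
      by (simp add: power_mult_distrib power_mult[symmetric] mult_ac)
  qed
  then show ?thesis
    using that[of "C * C1 ^ N"] \<open>C \<ge> 0\<close> \<open>C1 \<ge> 0\<close> by simp
qed

section \<open>The Neumann series along orbits\<close>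

text \<open>
  \<open>orbit_series x z (1 / \<zeta>) / \<zeta>\<close> is the value at \<open>z\<close> of the Neumann series of \<open>(\<zeta> - T)\<^sup>-\<^sup>1 x\<close>.
\<close>

definition orbit_series :: "'a \<Rightarrow> complex \<Rightarrow> complex \<Rightarrow> complex" where
  "orbit_series x z w = (\<Sum>n. \<iota> x ((\<phi> ^^ n) z) * w ^ n)"

lemma summable_orbit_series:
  assumes z: "z \<in> \<D>" and x: "x \<in> vanishing N" and w: "\<kappa> ^ N * norm w < 1"
  shows "summable (\<lambda>n. \<iota> x ((\<phi> ^^ n) z) * w ^ n)"
proof -
  obtain C where C: "\<And>n. norm (\<iota> x ((\<phi> ^^ n) z)) \<le> C * norm x * (\<kappa> ^ N) ^ n"
    using orbit_decay[OF z, of N] x by metis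
  have bound: "norm (\<iota> x ((\<phi> ^^ n) z) * w ^ n) \<le> C * norm x * (\<kappa> ^ N * norm w) ^ n" for n
  proof -
    have bound: "norm (\<iota> x ((\<phi> ^^ n) z) * w ^ n) \<le> C * norm x * (\<kappa> ^ N) ^ n * norm w ^ n"
      unfolding norm_mult norm_power by (intro mult_right_mono C) simp
    then show ?thesis
      by (simp add: power_mult_distrib mult_ac)
  qed
  have "summable (\<lambda>n. C * norm x * (\<kappa> ^ N * norm w) ^ n)"
    using w \<kappa> by (intro summable_mult summable_geometric) simp
  then show ?thesis
    by (rule summable_comparison_test') (rule bound)
qed

text \<open>Splitting off the first term. For \<open>w = 1 / \<zeta>\<close> this is the resolvent
  equation evaluated at a point.\<close>

lemma orbit_series_rec:
  assumes "z \<in> \<D>" "x \<in> vanishing N" "\<kappa> ^ N * norm w < 1"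
  shows "orbit_series x z w = \<iota> x z + w * orbit_series x (\<phi> z) w"
proof -
  have "orbit_series x z w = (\<Sum>n. \<iota> x ((\<phi> ^^ Suc n) z) * w ^ Suc n) + \<iota> x z"
    unfolding orbit_series_def using suminf_split_head[OF summable_orbit_series[OF assms]] by simp
  also have "(\<Sum>n. \<iota> x ((\<phi> ^^ Suc n) z) * w ^ Suc n) = (\<Sum>n. w * (\<iota> x ((\<phi> ^^ n) (\<phi> z)) * w ^ n))"
    by (simp add: funpow_swap1[of \<phi>] mult_ac)
  also have "\<dots> = w * orbit_series x (\<phi> z) w"
    unfolding orbit_series_def by (rule suminf_mult[OF summable_orbit_series[OF \<phi>_in_disc[OF assms(1)] assms(2,3)]])
  finally show ?thesis
    by simp
qed

text \<open>A power series in \<open>1 / \<zeta>\<close> whose domain is independent of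
  \<open>z\<close> and of the spectrum. This is the continuation across spectral points.\<close>

lemma orbit_series_holomorphic:
  assumes "z \<in> \<D>" "x \<in> vanishing N"
  shows "(\<lambda>\<zeta>. orbit_series x z (1 / \<zeta>) / \<zeta>) holomorphic_on {\<zeta>. \<kappa> ^ N < norm \<zeta>}"
proof -
  have pos: "\<kappa> ^ N > 0"
    using \<kappa> by simp
  then have nz: "\<zeta> \<noteq> 0" if "\<kappa> ^ N < norm \<zeta>" for \<zeta> :: complex
    using that by (metis norm_zero not_less_iff_gr_or_eq)
  have "orbit_series x z holomorphic_on ball 0 (1 / \<kappa> ^ N)"
  proof (rule power_series_holomorphic)
    fix w assume "w \<in> ball (0::complex) (1 / \<kappa> ^ N)"
    then have "\<kappa> ^ N * norm w < 1"
      using pos by (simp add: field_simps)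
    then show "(\<lambda>n. \<iota> x ((\<phi> ^^ n) z) * (w - 0) ^ n) sums orbit_series x z w"
      unfolding orbit_series_def using summable_sums[OF summable_orbit_series[OF assms]] by simp
  qed
  moreover have "(\<lambda>\<zeta>. 1 / \<zeta>) holomorphic_on {\<zeta>. \<kappa> ^ N < norm \<zeta>}"
    using nz by (intro holomorphic_intros) auto
  moreover have "(\<lambda>\<zeta>. 1 / \<zeta>) ` {\<zeta>. \<kappa> ^ N < norm \<zeta>} \<subseteq> ball (0::complex) (1 / \<kappa> ^ N)"
    using pos nz by (auto simp: norm_divide field_simps)
  ultimately have "(orbit_series x z \<circ> (\<lambda>\<zeta>. 1 / \<zeta>)) holomorphic_on {\<zeta>. \<kappa> ^ N < norm \<zeta>}"
    by (intro holomorphic_on_compose_gen)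
  then show ?thesis
    using nz by (intro holomorphic_on_divide holomorphic_on_ident) (auto simp: o_def)
qed

text \<open>With \<open>a n\<close> the value of \<open>g\<close> along the orbit divided by
  \<open>\<zeta> ^ n\<close>, the series telescopes and \<open>a n\<close> tends to
  \<open>0\<close>. Here \<zeta> may belong to the spectrum, so solutions in
  \<open>vanishing N\<close> are unique there as well.\<close>

lemma orbit_series_eq:
  assumes z: "z \<in> \<D>" and g: "g \<in> vanishing N" and \<zeta>: "\<kappa> ^ N < norm \<zeta>"
    and x: "x = \<zeta> *\<^sub>C g - T g"
  shows "\<iota> g z = orbit_series x z (1 / \<zeta>) / \<zeta>"
proof -
  have "\<zeta> \<noteq> 0"
    using \<zeta> \<kappa> by (metis norm_zero not_less_iff_gr_or_eq zero_less_power)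
  obtain C where C: "\<And>n. norm (\<iota> g ((\<phi> ^^ n) z)) \<le> C * norm g * (\<kappa> ^ N) ^ n"
    using orbit_decay[OF z, of N] g by metis
  define a where "a n = \<iota> g ((\<phi> ^^ n) z) / \<zeta> ^ n" for n
  have "norm (a n) \<le> C * norm g * (\<kappa> ^ N / norm \<zeta>) ^ n" for n
    using divide_right_mono[OF C[of n], of "norm \<zeta> ^ n"] by (simp add: a_def norm_divide norm_power power_divide)
  moreover have "(\<lambda>n. C * norm g * (\<kappa> ^ N / norm \<zeta>) ^ n) \<longlonglongrightarrow> 0"
    using \<zeta> \<kappa> by (intro tendsto_mult_right_zero LIMSEQ_power_zero) (simp add: divide_less_eq)
  ultimately have "a \<longlonglongrightarrow> 0"
    by (intro Lim_null_comparison[of a]) auto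
  then have "(\<lambda>n. a n - a (Suc n)) sums (a 0 - 0)"
    by (rule telescope_sums')
  moreover have "a n - a (Suc n) = \<iota> x ((\<phi> ^^ n) z) * (1 / \<zeta>) ^ n * (1 / \<zeta>)" for n
    using orbit_in_disc[OF z, of n] \<open>\<zeta> \<noteq> 0\<close>
    by (simp add: a_def x \<iota>_diff \<iota>_scaleC \<iota>_T field_simps del: mem_ball mem_ball_0)
  ultimately have "(\<lambda>n. \<iota> x ((\<phi> ^^ n) z) * (1 / \<zeta>) ^ n * (1 / \<zeta>)) sums \<iota> g z"
    by (simp add: a_def)
  moreover have "\<kappa> ^ N * norm (1 / \<zeta>) < 1"
    using \<zeta> \<open>\<zeta> \<noteq> 0\<close> by (simp add: norm_divide divide_less_eq)
  then have "(\<lambda>n. \<iota> x ((\<phi> ^^ n) z) * (1 / \<zeta>) ^ n * (1 / \<zeta>)) sums (orbit_series x z (1 / \<zeta>) * (1 / \<zeta>))"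
    unfolding orbit_series_def x using subspace_vanishing g
    by (intro sums_mult2 summable_sums summable_orbit_series[OF z])
      (auto intro!: T_vanishing complex_vector.subspace_diff complex_vector.subspace_scale)
  ultimately show ?thesis
    using sums_unique2 by fastforce
qed

lemma injective_on_vanishing:
  assumes g: "g \<in> vanishing N" and \<zeta>: "\<kappa> ^ N < norm \<zeta>" and eq: "\<zeta> *\<^sub>C g - T g = 0"
  shows "g = 0"
proof (rule \<iota>_eqI)
  fix z assume z: "z \<in> \<D>"
  have "\<iota> g z = orbit_series 0 z (1 / \<zeta>) / \<zeta>"
    by (rule orbit_series_eq[OF z g \<zeta>]) (simp add: eq)
  also have "orbit_series 0 z w = 0" for w
    unfolding orbit_series_def by (simp add: \<iota>_0[OF orbit_in_disc[OF z]])
  finally show "\<iota> g z = \<iota> 0 z"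
    using z by (simp add: \<iota>_0)
qed

lemma coeff_resolvent:
  assumes "x \<in> vanishing k"
  shows "coeff k (\<mu> *\<^sub>C x - T x) = (\<mu> - deriv \<phi> \<alpha> ^ k) * coeff k x"
  using assms by (simp add: coeff_diff coeff_scaleC coeff_T algebra_simps)

text \<open>By \<open>coeff_resolvent\<close> each successive coefficient is multiplied by a nonzero
  number, so the coefficients of \<open>g\<close> vanish one after another.\<close>

lemma resolvent_vanishing:
  assumes "\<mu> *\<^sub>C g - T g \<in> vanishing N" and "\<And>k. k < N \<Longrightarrow> \<mu> \<noteq> deriv \<phi> \<alpha> ^ k"
  shows "g \<in> vanishing N"
proof -
  have "g \<in> vanishing k" if "k \<le> N" for k
    using that
  proof (induction k)
    case (Suc k)
    then have "(\<mu> - deriv \<phi> \<alpha> ^ k) * coeff k g = 0"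
      using coeff_resolvent[of g k \<mu>] assms(1) by (simp add: vanishing_def)
    then show ?case
      using Suc assms(2)[of k] by (simp add: vanishing_Suc_iff)
  qed (simp add: vanishing_0)
  then show ?thesis
    by simp
qed

text \<open>
  As a function with values in \<open>Hol(\<D>)\<close>, the resolvent applied to \<open>x\<close> extends holomorphically across
  the spectral set \<open>S\<close>; the Cauchy formula recovers its values on \<open>S\<close> from values in the Banach space.
\<close>

lemma surjective_on_vanishing:
  assumes S: "compact S" "closed (\<sigma> T - S)" and large: "\<And>\<zeta>. \<zeta> \<in> S \<Longrightarrow> \<kappa> ^ N < norm \<zeta>"
    and \<mu>: "\<mu> \<in> S" and x: "x \<in> vanishing N"
  shows "\<exists>g\<in>vanishing N. \<mu> *\<^sub>C g - T g = x"
proof -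
  \<comment> \<open>Powers outside \<open>S\<close> are removed from \<open>U\<close>, so that the
    resolvent preserves \<open>vanishing N\<close> at every point of \<open>U - S\<close>.\<close>
  define E where "E = (\<lambda>k. deriv \<phi> \<alpha> ^ k) ` {..<N} - S"
  define U where "U = {\<zeta>. \<kappa> ^ N < norm \<zeta>} \<inter> - (\<sigma> T - S) \<inter> - E"
  have "open {\<zeta>::complex. \<kappa> ^ N < norm \<zeta>}"
    by (intro open_Collect_less continuous_intros)
  moreover have "closed E"
    unfolding E_def by (intro finite_imp_closed) simp
  ultimately have U: "open U"
    using S(2) unfolding U_def by (intro open_Int open_Compl)
  have SU: "S \<subseteq> U"
    using large by (auto simp: U_def E_def)
  obtain q M C V where q: "continuous_on UNIV q" and C: "compact C" "C \<subseteq> U" and V: "open V" "S \<subseteq> V"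
    and qV: "\<And>\<zeta>. \<zeta> \<in> V \<Longrightarrow> q \<zeta> = 0" and qC: "\<And>\<zeta>. \<zeta> \<notin> C \<Longrightarrow> q \<zeta> = 0"
    and cauchy: "\<And>w. w \<in> S \<Longrightarrow> \<exists>c. c \<noteq> 0 \<and> (\<forall>h. h holomorphic_on U \<longrightarrow>
        square_integral M (\<lambda>\<zeta>. q \<zeta> * h \<zeta> / (\<zeta> - w)) = c * h w)"
    by (rule cutoff_cauchy_formula[OF S(1) U SU]) (rule that; assumption)
  obtain c where "c \<noteq> 0" and c: "\<And>h. h holomorphic_on U \<Longrightarrow>
        square_integral M (\<lambda>\<zeta>. q \<zeta> * h \<zeta> / (\<zeta> - \<mu>)) = c * h \<mu>"
    using cauchy[OF \<mu>] by blast
  have res: "\<zeta> *\<^sub>C resolvent \<zeta> x - T (resolvent \<zeta> x) = x" "resolvent \<zeta> x \<in> vanishing N" if "\<zeta> \<in> U - S" for \<zeta>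
  proof -
    show eq: "\<zeta> *\<^sub>C resolvent \<zeta> x - T (resolvent \<zeta> x) = x"
      using that by (intro resolvent_eq) (auto simp: U_def)
    have "\<zeta> *\<^sub>C resolvent \<zeta> x - T (resolvent \<zeta> x) \<in> vanishing N"
      unfolding eq by (rule x)
    moreover have "\<zeta> \<noteq> deriv \<phi> \<alpha> ^ k" if "k < N" for k
      using \<open>\<zeta> \<in> U - S\<close> that by (auto simp: U_def E_def)
    ultimately show "resolvent \<zeta> x \<in> vanishing N"
      by (rule resolvent_vanishing)
  qed
  \<comment> \<open>The resolvent makes no sense on \<open>S\<close>; since \<open>q\<close>
    vanishes near \<open>S\<close> and off \<open>C\<close>, extending the integrand by
    \<open>0\<close> keeps it continuous.\<close>
  define G where "G \<zeta> = (if \<zeta> \<in> U - S then (q \<zeta> / (\<zeta> - \<mu>)) *\<^sub>C resolvent \<zeta> x else 0)" for \<zeta>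
  have cG: "continuous_on UNIV G"
    unfolding G_def
  proof (rule continuous_on_extend_0)
    show "open (U - S)" "closed (C - V)" "C - V \<subseteq> U - S"
      using U V C S by (auto intro: open_Diff closed_Diff compact_imp_closed)
    have "continuous_on (U - S) (\<lambda>\<zeta>. resolvent \<zeta> x)"
      by (rule continuous_on_subset[OF continuous_on_resolvent]) (auto simp: U_def)
    moreover have "continuous_on (U - S) (\<lambda>\<zeta>. q \<zeta> / (\<zeta> - \<mu>))"
      using \<mu> by (intro continuous_on_divide continuous_on_subset[OF q] continuous_intros) auto
    ultimately show "continuous_on (U - S) (\<lambda>\<zeta>. (q \<zeta> / (\<zeta> - \<mu>)) *\<^sub>C resolvent \<zeta> x)"
      by (intro bounded_bilinear.continuous_on[OF bounded_bilinear_scaleC])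
    show "(q \<zeta> / (\<zeta> - \<mu>)) *\<^sub>C resolvent \<zeta> x = 0" if "\<zeta> \<in> U - S - (C - V)" for \<zeta>
      using that qV[of \<zeta>] qC[of \<zeta>] by auto
  qed
  \<comment> \<open>The integral is formed in the Banach space. Evaluation at \<open>z\<close>
    passes inside it, and there the Cauchy formula returns the continued value at \<mu>.\<close>
  define g where "g = (1 / c) *\<^sub>C square_integral M G"
  have \<iota>_g: "\<iota> g z = orbit_series x z (1 / \<mu>) / \<mu>" if z: "z \<in> \<D>" for z
  proof -
    define h where "h \<zeta> = orbit_series x z (1 / \<zeta>) / \<zeta>" for \<zeta>
    have "h holomorphic_on U"
      unfolding h_def by (rule holomorphic_on_subset[OF orbit_series_holomorphic[OF z x]]) (auto simp: U_def)
    have "\<iota> (G \<zeta>) z = q \<zeta> * h \<zeta> / (\<zeta> - \<mu>)" for \<zeta>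
    proof (cases "\<zeta> \<in> U - S")
      case True
      then have "\<iota> (resolvent \<zeta> x) z = h \<zeta>"
        unfolding h_def using res[OF True] by (intro orbit_series_eq[OF z]) (auto simp: U_def)
      then show ?thesis
        using True z by (simp add: G_def \<iota>_scaleC)
    next
      case False
      then have "q \<zeta> = 0"
        using C V qV qC by blast
      then show ?thesis
        using False z by (simp add: G_def \<iota>_0)
    qed
    then have "\<iota> (square_integral M G) z = c * h \<mu>"
      using square_integral_linear[OF cG bounded_linear_\<iota>[OF z], of M] c[OF \<open>h holomorphic_on U\<close>] by simp
    then show ?thesis
      using z \<open>c \<noteq> 0\<close> by (simp add: g_def \<iota>_scaleC h_def)
  qed
  have "coeff k (G \<zeta>) = 0" if "k < N" for k \<zeta>
    using that res(2)[of \<zeta>] coeff_scaleC[of k 0 0] by (auto simp: G_def coeff_scaleC vanishing_def)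
  then have "coeff k (square_integral M G) = 0" if "k < N" for k
    using square_integral_linear[OF cG bounded_linear_coeff, of M k] that
    by (simp add: square_integral_def case_prod_unfold)
  then have "g \<in> vanishing N"
    by (simp add: vanishing_def g_def coeff_scaleC)
  moreover have "\<mu> *\<^sub>C g - T g = x"
  proof (rule \<iota>_eqI)
    fix z assume z: "z \<in> \<D>"
    have "\<kappa> ^ N < norm \<mu>"
      using large \<mu> by blast
    moreover have "\<kappa> ^ N > 0"
      using \<kappa> by simp
    ultimately have "\<mu> \<noteq> 0" "\<kappa> ^ N * norm (1 / \<mu>) < 1"
      using \<kappa> by (auto simp: norm_divide divide_less_eq)
    then show "\<iota> (\<mu> *\<^sub>C g - T g) z = \<iota> x z"
      using orbit_series_rec[OF z x, of "1 / \<mu>"] z \<phi>_in_disc[OF z]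
      by (simp add: \<iota>_diff \<iota>_scaleC \<iota>_T \<iota>_g del: mem_ball mem_ball_0)
  qed
  ultimately show ?thesis
    by blast
qed

section \<open>Splitting off an eigenvector along the filtration\<close>

lemma deriv_power_inj: "deriv \<phi> \<alpha> ^ m = deriv \<phi> \<alpha> ^ n \<Longrightarrow> m = n"
proof (rule ccontr)
  assume eq: "deriv \<phi> \<alpha> ^ m = deriv \<phi> \<alpha> ^ n" and "m \<noteq> n"
  have "norm (deriv \<phi> \<alpha>) ^ j < norm (deriv \<phi> \<alpha>) ^ i" if "i < j" for i j
    using that deriv_nz deriv_lt_1 by (intro power_strict_decreasing) auto
  from this[of m n] this[of n m] show False
    using eq \<open>m \<noteq> n\<close> by (metis linorder_neqE_nat less_irrefl norm_power)
qed

text \<open>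
  The line through \<open>e\<close> and \<open>W\<close> intersect trivially, because \<open>\<mu> - T\<close> kills the former and is
  injective on the latter.
\<close>

definition splits :: "complex \<Rightarrow> nat \<Rightarrow> nat \<Rightarrow> 'a \<Rightarrow> 'a set \<Rightarrow> bool" where
  "splits \<mu> N k e W \<longleftrightarrow>
     e \<in> vanishing k \<and> \<mu> *\<^sub>C e - T e = 0 \<and> (e = 0 \<or> (\<exists>n. k \<le> n \<and> n < N \<and> \<mu> = deriv \<phi> \<alpha> ^ n)) \<and>
     complex_vector.subspace W \<and> closed W \<and> W \<subseteq> vanishing k \<and>
     bij_betw (\<lambda>x. \<mu> *\<^sub>C x - T x) W W \<and> (\<forall>x\<in>vanishing k. \<exists>c. x - c *\<^sub>C e \<in> W)"

lemma resolvent_zero: "\<mu> *\<^sub>C 0 - T 0 = 0"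
  by (simp add: T.zero)

lemma resolvent_diff: "\<mu> *\<^sub>C (x - y) - T (x - y) = (\<mu> *\<^sub>C x - T x) - (\<mu> *\<^sub>C y - T y)"
  by (simp add: T.diff complex_vector.scale_right_diff_distrib)

lemma resolvent_add: "\<mu> *\<^sub>C (x + y) - T (x + y) = (\<mu> *\<^sub>C x - T x) + (\<mu> *\<^sub>C y - T y)"
  by (simp add: T.add scaleC_add_right)

lemma resolvent_scaleC: "\<mu> *\<^sub>C (c *\<^sub>C x) - T (c *\<^sub>C x) = c *\<^sub>C (\<mu> *\<^sub>C x - T x)"
  by (simp add: T_scaleC complex_vector.scale_right_diff_distrib scaleC_scaleC mult.commute)

lemma resolvent_in_vanishing: "x \<in> vanishing k \<Longrightarrow> \<mu> *\<^sub>C x - T x \<in> vanishing k"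
  using subspace_vanishing
  by (intro complex_vector.subspace_diff complex_vector.subspace_scale T_vanishing)

lemma bij_betw_resolventI:
  assumes W: "complex_vector.subspace W" and into: "\<And>x. x \<in> W \<Longrightarrow> \<mu> *\<^sub>C x - T x \<in> W"
    and inj: "\<And>x. x \<in> W \<Longrightarrow> \<mu> *\<^sub>C x - T x = 0 \<Longrightarrow> x = 0"
    and surj: "\<And>y. y \<in> W \<Longrightarrow> \<exists>x\<in>W. \<mu> *\<^sub>C x - T x = y"
  shows "bij_betw (\<lambda>x. \<mu> *\<^sub>C x - T x) W W"
proof (rule bij_betw_imageI)
  show "inj_on (\<lambda>x. \<mu> *\<^sub>C x - T x) W"
  proof (rule inj_onI)
    fix x y assume "x \<in> W" "y \<in> W" "\<mu> *\<^sub>C x - T x = \<mu> *\<^sub>C y - T y"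
    then have "\<mu> *\<^sub>C (x - y) - T (x - y) = 0"
      by (simp only: resolvent_diff right_minus_eq)
    then have "x - y = 0"
      by (rule inj[OF complex_vector.subspace_diff[OF W \<open>x \<in> W\<close> \<open>y \<in> W\<close>]])
    then show "x = y"
      by simp
  qed
  show "(\<lambda>x. \<mu> *\<^sub>C x - T x) ` W = W"
  proof
    show "W \<subseteq> (\<lambda>x. \<mu> *\<^sub>C x - T x) ` W"
    proof
      fix y assume "y \<in> W"
      then obtain x where "\<mu> *\<^sub>C x - T x = y" "x \<in> W"
        using surj[OF \<open>y \<in> W\<close>] by blast
      then show "y \<in> (\<lambda>x. \<mu> *\<^sub>C x - T x) ` W"
        by (rule image_eqI[OF sym])
    qed
  qed (use into in blast)
qed

text \<open>With \<open>e = 0\<close> below, \<open>W\<close> is all of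
  \<open>vanishing (Suc k)\<close>. Now \<open>\<mu> - T\<close> sends \<open>f\<close> into
  \<open>W\<close>, and subtracting the preimage \<open>h\<close> of the result in \<open>W\<close>
  turns \<open>f\<close> into an eigenvector; \<open>W\<close> stays as it is.\<close>

lemma splits_step_eigenvalue:
  assumes sp: "splits \<mu> N (Suc k) 0 W" and "k < N" and \<mu>: "\<mu> = deriv \<phi> \<alpha> ^ k"
    and f: "f \<in> vanishing k" "coeff k f = 1"
  shows "\<exists>e. splits \<mu> N k e W"
proof -
  have W: "complex_vector.subspace W" "closed W" "W \<subseteq> vanishing (Suc k)"
    and bij: "bij_betw (\<lambda>x. \<mu> *\<^sub>C x - T x) W W" and all: "\<And>x. x \<in> vanishing (Suc k) \<Longrightarrow> x \<in> W"
    using sp unfolding splits_def by auto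
  have "\<mu> *\<^sub>C f - T f \<in> vanishing (Suc k)"
    using f by (simp add: vanishing_Suc_iff resolvent_in_vanishing coeff_resolvent \<mu>)
  then obtain h where h: "h \<in> W" "\<mu> *\<^sub>C h - T h = \<mu> *\<^sub>C f - T f"
    using all bij unfolding bij_betw_def by (metis (no_types, lifting) imageE)
  define e where "e = f - h"
  have hk: "h \<in> vanishing k" "coeff k h = 0"
    using h W by (auto simp: vanishing_Suc_iff)
  have e: "e \<in> vanishing k" "coeff k e = 1"
    using f hk subspace_vanishing by (auto simp: e_def coeff_diff complex_vector.subspace_diff)
  have "\<mu> *\<^sub>C e - T e = 0"
    unfolding e_def resolvent_diff h by simp
  moreover have "\<exists>c. x - c *\<^sub>C e \<in> W" if "x \<in> vanishing k" for x
  proof -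
    have "x - coeff k x *\<^sub>C e \<in> vanishing (Suc k)"
      using that e subspace_vanishing[of k]
      by (simp add: vanishing_Suc_iff coeff_diff coeff_scaleC complex_vector.subspace_diff complex_vector.subspace_scale)
    then show ?thesis
      using all by blast
  qed
  moreover have "W \<subseteq> vanishing k"
    using W(3) by (auto simp: vanishing_Suc_iff)
  ultimately have "splits \<mu> N k e W"
    using e W bij \<mu> \<open>k < N\<close> unfolding splits_def by blast
  then show ?thesis ..
qed

text \<open>On the new direction \<open>\<mu> - T\<close> acts as the nonzero scalar
  \<open>d\<close>. Enlarging \<open>W\<close> by a corrected \<open>f\<close> makes the operator
  triangular, hence bijective on the larger space, while \<open>e\<close> is kept.\<close>

lemma splits_step_regular:
  assumes sp: "splits \<mu> N (Suc k) e W" and \<mu>: "\<mu> \<noteq> deriv \<phi> \<alpha> ^ k"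
    and f: "f \<in> vanishing k" "coeff k f = 1"
  shows "\<exists>W. splits \<mu> N k e W"
proof -
  have W: "complex_vector.subspace W" "closed W" "W \<subseteq> vanishing (Suc k)"
    and bij: "bij_betw (\<lambda>x. \<mu> *\<^sub>C x - T x) W W"
    and all: "\<And>x. x \<in> vanishing (Suc k) \<Longrightarrow> \<exists>c. x - c *\<^sub>C e \<in> W"
    and e: "e \<in> vanishing (Suc k)" "\<mu> *\<^sub>C e - T e = 0"
    and ev: "e = 0 \<or> (\<exists>n. Suc k \<le> n \<and> n < N \<and> \<mu> = deriv \<phi> \<alpha> ^ n)"
    using sp unfolding splits_def by blast+
  note V = subspace_vanishing[of k]
  have Wk: "w \<in> vanishing k" "coeff k w = 0" if "w \<in> W" for w
    using that W(3) by (auto simp: vanishing_Suc_iff)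
  have ek: "e \<in> vanishing k" "coeff k e = 0"
    using e by (auto simp: vanishing_Suc_iff)
  define d where "d = \<mu> - deriv \<phi> \<alpha> ^ k"
  have "d \<noteq> 0"
    using \<mu> by (simp add: d_def)
  have "coeff k ((\<mu> *\<^sub>C f - T f) - d *\<^sub>C f) = 0"
    unfolding coeff_diff[of k "\<mu> *\<^sub>C f - T f"] coeff_resolvent[OF f(1)] coeff_scaleC
    by (simp add: d_def f)
  moreover have "(\<mu> *\<^sub>C f - T f) - d *\<^sub>C f \<in> vanishing k"
    using f V by (intro complex_vector.subspace_diff complex_vector.subspace_scale resolvent_in_vanishing)
  ultimately have "(\<mu> *\<^sub>C f - T f) - d *\<^sub>C f \<in> vanishing (Suc k)"
    by (simp only: vanishing_Suc_iff)
  then obtain s where s: "(\<mu> *\<^sub>C f - T f) - d *\<^sub>C f - s *\<^sub>C e \<in> W"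
    using all by blast
  \<comment> \<open>The summand \<open>(s / d) *\<^sub>C e\<close> absorbs the component
    \<open>s *\<^sub>C e\<close>, because \<open>\<mu> - T\<close> kills \<open>e\<close>; the
    remainder \<open>w\<close> then lies in \<open>W\<close>.\<close>
  define f' where "f' = f + (s / d) *\<^sub>C e"
  define w where "w = (\<mu> *\<^sub>C f - T f) - d *\<^sub>C f - s *\<^sub>C e"
  have "w \<in> W"
    using s by (simp add: w_def)
  have Af': "\<mu> *\<^sub>C f' - T f' = d *\<^sub>C f' + w"
    unfolding f'_def resolvent_add resolvent_scaleC e(2) w_def using \<open>d \<noteq> 0\<close>
    by (simp add: scaleC_add_right scaleC_scaleC)
  have f': "f' \<in> vanishing k" "coeff k f' = 1"
    using f ek V by (auto simp: f'_def coeff_add coeff_scaleC complex_vector.subspace_add complex_vector.subspace_scale)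
  \<comment> \<open>This is the sum of \<open>W\<close> and the line through \<open>f'\<close>.
    Written through \<open>coeff k\<close>, it is visibly closed, as part of a preimage of
    \<open>W\<close>.\<close>
  define W' where "W' = {y \<in> vanishing k. y - coeff k y *\<^sub>C f' \<in> W}"
  have W'I: "v + b *\<^sub>C f' \<in> W'" if "v \<in> W" for v b
    using that Wk[OF that] f' V
    by (simp add: W'_def coeff_add coeff_scaleC complex_vector.subspace_add complex_vector.subspace_scale)
  have W'E: "\<exists>v\<in>W. y = v + coeff k y *\<^sub>C f'" if "y \<in> W'" for y
    using that by (intro bexI[of _ "y - coeff k y *\<^sub>C f'"]) (auto simp: W'_def)
  have sub: "complex_vector.subspace W'"
  proof (rule complex_vector.subspaceI)
    show "0 \<in> W'"
      using W'I[of 0 0] complex_vector.subspace_0[OF W(1)] by simp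
    fix x y assume "x \<in> W'" "y \<in> W'"
    then have "x + y \<in> vanishing k" "(x - coeff k x *\<^sub>C f') + (y - coeff k y *\<^sub>C f') \<in> W"
      using V W(1) unfolding W'_def by (auto intro: complex_vector.subspace_add)
    moreover have "(x - coeff k x *\<^sub>C f') + (y - coeff k y *\<^sub>C f') = (x + y) - coeff k (x + y) *\<^sub>C f'"
      by (simp add: coeff_add scaleC_add_left)
    ultimately show "x + y \<in> W'"
      by (simp add: W'_def)
  next
    fix c x assume "x \<in> W'"
    then have "c *\<^sub>C x \<in> vanishing k" "c *\<^sub>C (x - coeff k x *\<^sub>C f') \<in> W"
      using V W(1) unfolding W'_def by (auto intro: complex_vector.subspace_scale)
    then show "c *\<^sub>C x \<in> W'"
      by (simp add: W'_def coeff_scaleC complex_vector.scale_right_diff_distrib scaleC_scaleC)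
  qed
  have "closed W'"
  proof -
    have "continuous_on UNIV (\<lambda>y. y - coeff k y *\<^sub>C f')"
      by (intro continuous_intros bounded_bilinear.continuous_on[OF bounded_bilinear_scaleC]
          linear_continuous_on bounded_linear_coeff)
    then have "closed ((\<lambda>y. y - coeff k y *\<^sub>C f') -` W)"
      using W(2) by (intro closed_vimage)
    moreover have "W' = vanishing k \<inter> (\<lambda>y. y - coeff k y *\<^sub>C f') -` W"
      by (auto simp: W'_def)
    ultimately show ?thesis
      using closed_vanishing by auto
  qed
  have A: "\<mu> *\<^sub>C (v + b *\<^sub>C f') - T (v + b *\<^sub>C f') = ((\<mu> *\<^sub>C v - T v) + b *\<^sub>C w) + (b * d) *\<^sub>C f'" for v b
    unfolding resolvent_add resolvent_scaleC Af' by (simp add: scaleC_add_right scaleC_scaleC)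
  have AW: "\<mu> *\<^sub>C v - T v \<in> W" if "v \<in> W" for v
    using bij that by (auto simp: bij_betw_def)
  have "bij_betw (\<lambda>x. \<mu> *\<^sub>C x - T x) W' W'"
  proof (rule bij_betw_resolventI[OF sub])
    fix y assume "y \<in> W'"
    then obtain v b where v: "v \<in> W" and y: "y = v + b *\<^sub>C f'"
      using W'E by blast
    show "\<mu> *\<^sub>C y - T y \<in> W'"
      unfolding y A using v \<open>w \<in> W\<close> W(1) AW
      by (intro W'I complex_vector.subspace_add complex_vector.subspace_scale)
    have Cy: "coeff k y = b"
      using Wk[OF v] f' by (simp add: y coeff_add coeff_scaleC)
    have yk: "y \<in> vanishing k"
      using \<open>y \<in> W'\<close> by (simp add: W'_def)
    show "y = 0" if "\<mu> *\<^sub>C y - T y = 0"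
    proof -
      have "d * b = 0"
        using coeff_resolvent[OF yk, of \<mu>] that coeff_scaleC[of k 0 0] Cy by (simp add: d_def)
      then have "y = v"
        using \<open>d \<noteq> 0\<close> by (simp add: y)
      moreover have "0 \<in> W"
        using W(1) by (rule complex_vector.subspace_0)
      ultimately show ?thesis
        using bij v that resolvent_zero unfolding bij_betw_def inj_on_def by metis
    qed
    \<comment> \<open>Back substitution: \<open>b / d\<close> is the coordinate along
      \<open>f'\<close>, and its contribution \<open>w\<close> is then compensated inside
      \<open>W\<close>.\<close>
    have "v - (b / d) *\<^sub>C w \<in> W"
      using v \<open>w \<in> W\<close> W(1) by (intro complex_vector.subspace_diff complex_vector.subspace_scale)
    then obtain u where u: "u \<in> W" "\<mu> *\<^sub>C u - T u = v - (b / d) *\<^sub>C w"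
      using bij unfolding bij_betw_def by (metis (no_types, lifting) imageE)
    have "\<mu> *\<^sub>C (u + (b / d) *\<^sub>C f') - T (u + (b / d) *\<^sub>C f') = y"
      unfolding A u y using \<open>d \<noteq> 0\<close> by simp
    then show "\<exists>x\<in>W'. \<mu> *\<^sub>C x - T x = y"
      using W'I[OF u(1)] by blast
  qed
  moreover have "\<exists>c. x - c *\<^sub>C e \<in> W'" if x: "x \<in> vanishing k" for x
  proof -
    have "x - coeff k x *\<^sub>C f' \<in> vanishing (Suc k)"
      using x f' V
      by (simp add: vanishing_Suc_iff coeff_diff coeff_scaleC complex_vector.subspace_diff complex_vector.subspace_scale)
    then obtain c where c: "x - coeff k x *\<^sub>C f' - c *\<^sub>C e \<in> W"
      using all by blast
    have "(x - coeff k x *\<^sub>C f' - c *\<^sub>C e) + coeff k x *\<^sub>C f' = x - c *\<^sub>C e"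
      by simp
    then show ?thesis
      using W'I[OF c] by metis
  qed
  moreover have "W' \<subseteq> vanishing k"
    by (auto simp: W'_def)
  moreover have "e = 0 \<or> (\<exists>n. k \<le> n \<and> n < N \<and> \<mu> = deriv \<phi> \<alpha> ^ n)"
    using ev Suc_leD by blast
  ultimately have "splits \<mu> N k e W'"
    using ek e sub \<open>closed W'\<close> unfolding splits_def by blast
  then show ?thesis ..
qed

text \<open>Descending induction from \<open>N\<close>, where \<open>\<mu> - T\<close> is already
  bijective, down to \<open>0\<close>. A level with no element of exact order \<open>k\<close>
  changes nothing, and at most one level is an eigenvalue step.\<close>

lemma splits_exists:
  assumes inj: "\<And>x. x \<in> vanishing N \<Longrightarrow> \<mu> *\<^sub>C x - T x = 0 \<Longrightarrow> x = 0"
    and surj: "\<And>y. y \<in> vanishing N \<Longrightarrow> \<exists>x\<in>vanishing N. \<mu> *\<^sub>C x - T x = y"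
  shows "k \<le> N \<Longrightarrow> \<exists>e W. splits \<mu> N k e W"
proof (induction k rule: inc_induct)
  case base
  have "splits \<mu> N N 0 (vanishing N)"
    unfolding splits_def
    using subspace_vanishing[of N] closed_vanishing
      bij_betw_resolventI[OF subspace_vanishing resolvent_in_vanishing inj surj]
    by (auto simp: complex_vector.subspace_0 T.zero)
  then show ?case
    by blast
next
  case (step k)
  then obtain e W where sp: "splits \<mu> N (Suc k) e W"
    by blast
  show ?case
  proof (cases "vanishing k \<subseteq> vanishing (Suc k)")
    case True
    then have "vanishing k = vanishing (Suc k)"
      by (auto simp: vanishing_Suc_iff)
    then have "splits \<mu> N k e W"
      using sp Suc_leD unfolding splits_def by metis
    then show ?thesis
      by blast
  next
    case False
    then obtain f0 where "f0 \<in> vanishing k" "f0 \<notin> vanishing (Suc k)"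
      by blast
    then have f0: "f0 \<in> vanishing k" "coeff k f0 \<noteq> 0"
      by (simp_all add: vanishing_Suc_iff)
    define f where "f = (1 / coeff k f0) *\<^sub>C f0"
    have f: "f \<in> vanishing k" "coeff k f = 1"
      using f0 subspace_vanishing by (auto simp: f_def coeff_scaleC complex_vector.subspace_scale)
    show ?thesis
    proof (cases "\<mu> = deriv \<phi> \<alpha> ^ k")
      case True
      \<comment> \<open>A nonzero \<open>e\<close> would make \<mu> also a higher power of the
        multiplier, but the powers are distinct.\<close>
      have "e = 0"
        using sp True deriv_power_inj unfolding splits_def by (metis Suc_n_not_le_n)
      then show ?thesis
        using splits_step_eigenvalue[of \<mu> N k W f] sp step True f by blast
    next
      case False
      then show ?thesis
        using splits_step_regular[OF sp False f] by blast
    qed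
  qed
qed

text \<open>\<open>N\<close> is chosen so that \<open>\<kappa> ^ N\<close> is smaller than all
  moduli on \<open>S\<close>. Splitting at every point of \<open>S\<close> shows that
  \<open>S\<close> consists of powers with exponent below \<open>N\<close>, so it is finite; the
  splitting at \<mu> is the Riesz decomposition.\<close>

lemma spectral_part_isolated:
  assumes S: "S \<subseteq> \<sigma> T" "compact S" "closed (\<sigma> T - S)" "0 \<notin> S" and \<mu>: "\<mu> \<in> S"
  shows "\<exists>n. \<mu> = deriv \<phi> \<alpha> ^ n" and "\<mu> isolated_in \<sigma> T" and "riesz_point T \<mu>"
proof -
  obtain \<delta> where "\<delta> > 0" and \<delta>: "\<And>\<zeta>. \<zeta> \<in> S \<Longrightarrow> \<delta> \<le> norm \<zeta>"
    using separate_point_closed[OF compact_imp_closed[OF S(2)] S(4)] by (auto simp: dist_norm)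
  obtain N where "\<kappa> ^ N < \<delta>"
    using real_arch_pow_inv[OF \<open>\<delta> > 0\<close> \<kappa>(2)] by blast
  then have large: "\<kappa> ^ N < norm \<zeta>" if "\<zeta> \<in> S" for \<zeta>
    using \<delta>[OF that] by linarith
  have split: "\<exists>e W. splits \<zeta> N 0 e W \<and> e \<noteq> 0" if \<zeta>: "\<zeta> \<in> S" for \<zeta>
  proof -
    obtain e W where sp: "splits \<zeta> N 0 e W"
      using splits_exists[of N \<zeta> 0] injective_on_vanishing large[OF \<zeta>]
        surjective_on_vanishing[OF S(2,3) large \<zeta>] by blast
    have "e \<noteq> 0"
    proof
      \<comment> \<open>Without an eigenvector \<open>W\<close> would be the whole space, on which
        \<open>\<zeta> - T\<close> is bijective.\<close>
      assume "e = 0"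
      then have "W = UNIV"
        using sp by (auto simp: splits_def vanishing_0)
      then have "\<zeta> \<notin> \<sigma> T"
        using sp by (intro bij_imp_notin_spectrum) (simp add: splits_def)
      then show False
        using \<zeta> S(1) by blast
    qed
    then show ?thesis
      using sp by blast
  qed
  then have pow: "\<exists>n<N. \<zeta> = deriv \<phi> \<alpha> ^ n" if "\<zeta> \<in> S" for \<zeta>
    using that unfolding splits_def by blast
  then show "\<exists>n. \<mu> = deriv \<phi> \<alpha> ^ n"
    using \<mu> by blast
  show iso: "\<mu> isolated_in \<sigma> T"
    unfolding isolated_in_def
  proof (intro conjI exI)
    have "S \<subseteq> (\<lambda>n. deriv \<phi> \<alpha> ^ n) ` {..<N}"
      using pow by blast
    then have "finite S"
      by (rule finite_subset) simp
    then have "closed (S - {\<mu>})"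
      by (intro finite_imp_closed) simp
    then show "open (- (\<sigma> T - S) \<inter> - (S - {\<mu>}))"
      using S(3) by (intro open_Int open_Compl)
    show "- (\<sigma> T - S) \<inter> - (S - {\<mu>}) \<inter> \<sigma> T = {\<mu>}"
      using \<mu> S(1) by blast
  qed (use \<mu> S(1) in blast)
  obtain e W where "splits \<mu> N 0 e W" and "e \<noteq> 0"
    using split[OF \<mu>] by blast
  then have e: "\<mu> *\<^sub>C e - T e = 0" and W: "complex_vector.subspace W" "closed W"
    and bij: "bij_betw (\<lambda>x. \<mu> *\<^sub>C x - T x) W W" and all: "\<And>x. \<exists>c. x - c *\<^sub>C e \<in> W"
    by (auto simp: splits_def vanishing_0)
  define X1 where "X1 = range (\<lambda>c. c *\<^sub>C e)"
  \<comment> \<open>The eigenline is the full kernel of \<open>\<mu> - T\<close>, which makes it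
    closed and disjoint from \<open>W\<close> apart from \<open>0\<close>.\<close>
  have ker: "x \<in> X1 \<longleftrightarrow> \<mu> *\<^sub>C x - T x = 0" for x
  proof
    show "\<mu> *\<^sub>C x - T x = 0" if "x \<in> X1"
    proof -
      obtain c where x: "x = c *\<^sub>C e"
        using \<open>x \<in> X1\<close> by (auto simp: X1_def)
      show ?thesis
        unfolding x resolvent_scaleC e by simp
    qed
    assume x: "\<mu> *\<^sub>C x - T x = 0"
    obtain c where c: "x - c *\<^sub>C e \<in> W"
      using all by blast
    have "\<mu> *\<^sub>C (x - c *\<^sub>C e) - T (x - c *\<^sub>C e) = 0"
      unfolding resolvent_diff resolvent_scaleC x e by simp
    then have "x - c *\<^sub>C e = 0"
      using bij c complex_vector.subspace_0[OF W(1)] resolvent_zero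
      unfolding bij_betw_def inj_on_def by metis
    then have "x = c *\<^sub>C e"
      by simp
    then show "x \<in> X1"
      unfolding X1_def by (rule range_eqI)
  qed
  have TX1: "T x = \<mu> *\<^sub>C x" if "x \<in> X1" for x
    using that by (simp add: ker)
  have X1_span: "X1 = complex_vector.span {e}"
    by (simp add: X1_def complex_vector.span_singleton)
  then have X1: "complex_vector.subspace X1" "finite_dimensional X1"
    unfolding finite_dimensional_def by (auto simp: complex_vector.subspace_span intro!: exI[of _ "{e}"])
  have clX1: "closed X1"
  proof -
    have "X1 = (\<lambda>x. \<mu> *\<^sub>C x - T x) -` {0}"
      by (rule set_eqI) (simp only: ker vimage_eq singleton_iff)
    then show ?thesis
      by (auto intro!: closed_vimage linear_continuous_on bounded_linear_resolvent)
  qed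
  have "spectrum_on X1 T = {\<mu>}"
  proof -
    have "\<not> invertible_on X1 (\<lambda>x. \<mu> *\<^sub>C x - T x)"
    proof
      assume "invertible_on X1 (\<lambda>x. \<mu> *\<^sub>C x - T x)"
      then have "inj_on (\<lambda>x. \<mu> *\<^sub>C x - T x) X1"
        by (simp add: invertible_on_def bij_betw_def)
      moreover have "e \<in> X1" "0 \<in> X1"
        using e by (simp_all add: ker T.zero)
      ultimately show False
        using \<open>e \<noteq> 0\<close> e resolvent_zero unfolding inj_on_def by metis
    qed
    moreover have "invertible_on X1 (\<lambda>x. \<nu> *\<^sub>C x - T x)" if "\<nu> \<noteq> \<mu>" for \<nu>
    proof (rule invertible_on_closed_subspace[OF complex_subspace_imp_subspace[OF X1(1)] clX1 bounded_linear_resolvent])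
      have eq: "\<nu> *\<^sub>C x - T x = (\<nu> - \<mu>) *\<^sub>C x" if "x \<in> X1" for x
        using TX1[OF that] by (simp add: complex_vector.scale_left_diff_distrib)
      show "bij_betw (\<lambda>x. \<nu> *\<^sub>C x - T x) X1 X1"
      proof (rule bij_betw_byWitness[of _ "\<lambda>x. (1 / (\<nu> - \<mu>)) *\<^sub>C x"])
        show "\<forall>x\<in>X1. \<nu> *\<^sub>C (1 / (\<nu> - \<mu>)) *\<^sub>C x - T ((1 / (\<nu> - \<mu>)) *\<^sub>C x) = x"
        proof
          fix x assume "x \<in> X1"
          show "\<nu> *\<^sub>C (1 / (\<nu> - \<mu>)) *\<^sub>C x - T ((1 / (\<nu> - \<mu>)) *\<^sub>C x) = x"
            unfolding eq[OF complex_vector.subspace_scale[OF X1(1) \<open>x \<in> X1\<close>]] using that by simp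
        qed
      qed (use that X1(1) in \<open>auto simp: eq complex_vector.subspace_scale\<close>)
    qed
    ultimately show ?thesis
      unfolding spectrum_on_def by auto
  qed
  moreover have "T ` X1 \<subseteq> X1"
    using X1(1) by (auto simp: TX1 complex_vector.subspace_scale)
  moreover have "T ` W \<subseteq> W"
  proof
    fix y assume "y \<in> T ` W"
    then obtain x where x: "x \<in> W" "y = T x"
      by blast
    have "\<mu> *\<^sub>C x - T x \<in> W"
      using bij x(1) unfolding bij_betw_def by blast
    then have "\<mu> *\<^sub>C x - (\<mu> *\<^sub>C x - T x) \<in> W"
      by (rule complex_vector.subspace_diff[OF W(1) complex_vector.subspace_scale[OF W(1) x(1)]])
    then show "y \<in> W"
      by (simp add: x)
  qed
  moreover have "X1 \<inter> W = {0}"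
  proof -
    have "x = 0" if "x \<in> X1" "x \<in> W" for x
      using bij that complex_vector.subspace_0[OF W(1)] resolvent_zero
      unfolding ker bij_betw_def inj_on_def by metis
    then show ?thesis
      using X1(1) W(1) complex_vector.subspace_0 by blast
  qed
  moreover have "{x + y | x y. x \<in> X1 \<and> y \<in> W} = UNIV"
  proof -
    have "\<exists>x y. z = x + y \<and> x \<in> X1 \<and> y \<in> W" for z
    proof -
      obtain c where "z - c *\<^sub>C e \<in> W"
        using all by blast
      moreover have "c *\<^sub>C e \<in> X1"
        unfolding X1_def by (rule rangeI)
      moreover have "z = c *\<^sub>C e + (z - c *\<^sub>C e)"
        by simp
      ultimately show ?thesis
        by blast
    qed
    then show ?thesis
      by blast
  qed
  moreover have "invertible_on W (\<lambda>x. \<mu> *\<^sub>C x - T x)"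
    using invertible_on_closed_subspace[OF complex_subspace_imp_subspace[OF W(1)] W(2) bounded_linear_resolvent bij] .
  ultimately show "riesz_point T \<mu>"
    unfolding riesz_point_def using iso X1 clX1 W by blast
qed

section \<open>Zero is in the spectrum and is not a Riesz point\<close>

text \<open>Going back \<open>n\<close> steps under \<open>T\<close> inside \<open>V\<close> costs
  at most \<open>L ^ n\<close> in norm, while evaluation along the orbit gains
  \<open>(\<kappa> ^ N) ^ n\<close>. Taking \<open>L * \<kappa> ^ N < 1\<close> forces every value
  of \<open>x\<close> to be \<open>0\<close>.\<close>

lemma invertible_on_vanishing_trivial:
  assumes V: "complex_vector.subspace V" and inv: "invertible_on V (\<lambda>x. 0 *\<^sub>C x - T x)"
  obtains N where "V \<inter> vanishing N \<subseteq> {0}"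
proof -
  define B where "B = inv_into V (\<lambda>x. 0 *\<^sub>C x - T x)"
  obtain K where bij: "bij_betw (\<lambda>x. 0 *\<^sub>C x - T x) V V" and K: "\<And>y. y \<in> V \<Longrightarrow> norm (B y) \<le> K * norm y"
    using inv unfolding invertible_on_def B_def by blast
  define L where "L = \<bar>K\<bar> + 1"
  have "L > 0"
    by (simp add: L_def)
  have preimage: "\<exists>u\<in>V. T u = y \<and> norm u \<le> L * norm y" if y: "y \<in> V" for y
  proof -
    have im: "y \<in> (\<lambda>x. 0 *\<^sub>C x - T x) ` V"
      using bij y by (simp only: bij_betw_imp_surj_on)
    have "B y \<in> V" "0 *\<^sub>C B y - T (B y) = y"
      unfolding B_def by (rule inv_into_into[OF im], rule f_inv_into_f[OF im])
    \<comment> \<open>\<open>B\<close> inverts \<open>0 - T\<close>, so the preimage under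
      \<open>T\<close> carries a minus sign.\<close>
    then have "- B y \<in> V" "T (- B y) = y"
      using complex_vector.subspace_neg[OF V] by (auto simp: T.neg)
    moreover have "K * norm y \<le> L * norm y"
      by (intro mult_right_mono) (auto simp: L_def)
    then have "norm (- B y) \<le> L * norm y"
      using K[OF y] by simp
    ultimately show ?thesis
      by blast
  qed
  obtain N where "\<kappa> ^ N < 1 / L"
    using real_arch_pow_inv[of "1 / L"] \<open>L > 0\<close> \<kappa>(2) by auto
  then have small: "L * \<kappa> ^ N < 1"
    using \<open>L > 0\<close> by (simp add: field_simps)
  have "x = 0" if x: "x \<in> V" "x \<in> vanishing N" for x
  proof (rule \<iota>_eqI)
    fix z assume z: "z \<in> \<D>"
    obtain C where "C \<ge> 0" and C: "\<And>y n. y \<in> vanishing N \<Longrightarrow> norm (\<iota> y ((\<phi> ^^ n) z)) \<le> C * norm y * (\<kappa> ^ N) ^ n"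
      by (rule orbit_decay[OF z, of N]) (rule that; assumption)
    have pre: "\<exists>y\<in>V. y \<in> vanishing N \<and> (T ^^ n) y = x \<and> norm y \<le> L ^ n * norm x" for n
    proof (induction n)
      case 0
      then show ?case
        using x by auto
    next
      case (Suc n)
      then obtain y where y: "y \<in> V" "y \<in> vanishing N" "(T ^^ n) y = x" "norm y \<le> L ^ n * norm x"
        by blast
      obtain u where u: "u \<in> V" "T u = y" "norm u \<le> L * norm y"
        using preimage[OF y(1)] by blast
      have "u \<in> vanishing N"
        using u y by (simp add: vanishing_T_imp)
      moreover have "(T ^^ Suc n) u = x"
        using u y by (simp add: funpow_swap1)
      moreover have "norm u \<le> L ^ Suc n * norm x"
        using order_trans[OF u(3) mult_left_mono[OF y(4)]] \<open>L > 0\<close> by (simp add: mult_ac)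
      ultimately show ?case
        using u(1) by blast
    qed
    have "norm (\<iota> x z) \<le> C * norm x * (L * \<kappa> ^ N) ^ n" for n
    proof -
      obtain y where y: "y \<in> vanishing N" "(T ^^ n) y = x" "norm y \<le> L ^ n * norm x"
        using pre by blast
      have "\<iota> x z = \<iota> y ((\<phi> ^^ n) z)"
        using \<iota>_funpow[OF z, of n y] y(2) by simp
      also have "norm \<dots> \<le> C * norm y * (\<kappa> ^ N) ^ n"
        using C[OF y(1)] .
      also have "\<dots> \<le> C * (L ^ n * norm x) * (\<kappa> ^ N) ^ n"
        using y(3) \<open>C \<ge> 0\<close> \<kappa> by (intro mult_right_mono mult_left_mono) auto
      finally show ?thesis
        by (simp add: power_mult_distrib mult_ac)
    qed
    moreover have "(\<lambda>n. C * norm x * (L * \<kappa> ^ N) ^ n) \<longlonglongrightarrow> 0"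
      using small \<open>L > 0\<close> \<kappa> by (intro tendsto_mult_right_zero LIMSEQ_power_zero) auto
    ultimately have "norm (\<iota> x z) \<le> 0"
      by (intro LIMSEQ_le_const) auto
    then show "\<iota> x z = \<iota> 0 z"
      using \<iota>_0[OF z] by simp
  qed
  then show ?thesis
    using that by blast
qed

text \<open>Going down the filtration, each level adds at most one vector to a spanning set for the
  intersection with \<open>V\<close>.\<close>

lemma span_bound_if_vanishing_trivial:
  assumes V: "complex_vector.subspace V" and triv: "V \<inter> vanishing N \<subseteq> {0}"
  obtains B where "finite B" "V \<subseteq> complex_vector.span B"
proof -
  have "k \<le> N \<Longrightarrow> \<exists>B. finite B \<and> V \<inter> vanishing k \<subseteq> complex_vector.span B" for k
  proof (induction k rule: inc_induct)
    case base
    show ?case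
      using triv by (intro exI[of _ "{}"]) simp
  next
    case (step k)
    then obtain B where B: "finite B" "V \<inter> vanishing (Suc k) \<subseteq> complex_vector.span B"
      by blast
    show ?case
    proof (cases "V \<inter> vanishing k \<subseteq> vanishing (Suc k)")
      case True
      then show ?thesis
        using B by blast
    next
      case False
      then obtain v where v: "v \<in> V" "v \<in> vanishing k" "v \<notin> vanishing (Suc k)"
        by blast
      then have cv: "coeff k v \<noteq> 0"
        by (simp add: vanishing_Suc_iff)
      have "x \<in> complex_vector.span (insert v B)" if x: "x \<in> V" "x \<in> vanishing k" for x
      proof -
        have "x - (coeff k x / coeff k v) *\<^sub>C v \<in> vanishing k"
          using x v subspace_vanishing by (intro complex_vector.subspace_diff complex_vector.subspace_scale)
        then have "x - (coeff k x / coeff k v) *\<^sub>C v \<in> vanishing (Suc k)"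
          using cv by (simp add: vanishing_Suc_iff coeff_diff coeff_scaleC)
        moreover have "x - (coeff k x / coeff k v) *\<^sub>C v \<in> V"
          using x v V by (intro complex_vector.subspace_diff complex_vector.subspace_scale)
        ultimately show ?thesis
          using B(2) complex_vector.span_breakdown_eq by blast
      qed
      then show ?thesis
        using B(1) by (intro exI[of _ "insert v B"]) auto
    qed
  qed
  from this[of 0] show ?thesis
    using that by (auto simp: vanishing_0)
qed

lemma invertible_imp_finite_dimensional_hull:
  assumes "complex_vector.subspace V" "invertible_on V (\<lambda>x. 0 *\<^sub>C x - T x)"
  obtains B where "finite B" "V \<subseteq> complex_vector.span B"
proof -
  obtain N where "V \<inter> vanishing N \<subseteq> {0}"
    by (rule invertible_on_vanishing_trivial[OF assms])
  from span_bound_if_vanishing_trivial[OF assms(1) this] show ?thesis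
    using that by blast
qed

text \<open>Either failure would put the whole space in the span of a finite set; for a Riesz point
  the spans of the two summands are joined.\<close>

lemma zero_in_spectrum:
  assumes "\<not> finite_dimensional (UNIV :: 'a set)"
  shows "0 \<in> \<sigma> T" and "\<not> riesz_point T 0"
proof -
  show "0 \<in> \<sigma> T"
  proof (rule ccontr)
    assume "0 \<notin> \<sigma> T"
    then have "invertible_on UNIV (\<lambda>x. 0 *\<^sub>C x - T x)"
      by (simp add: spectrum_on_def)
    then obtain B :: "'a set" where "finite B" "UNIV \<subseteq> complex_vector.span B"
      using invertible_imp_finite_dimensional_hull[OF complex_vector.subspace_UNIV] by blast
    then show False
      using assms unfolding finite_dimensional_def by blast
  qed
  show "\<not> riesz_point T 0"
  proof
    assume "riesz_point T 0"
    then obtain X1 X2 where sum: "{x + y | x y. x \<in> X1 \<and> y \<in> X2} = UNIV" and "finite_dimensional X1"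
      and X2: "complex_vector.subspace X2" "invertible_on X2 (\<lambda>x. 0 *\<^sub>C x - T x)"
      unfolding riesz_point_def by (elim conjE exE) (rule that; assumption)
    obtain B1 where B1: "finite B1" "complex_vector.span B1 = X1"
      using \<open>finite_dimensional X1\<close> unfolding finite_dimensional_def by blast
    obtain B2 where B2: "finite B2" "X2 \<subseteq> complex_vector.span B2"
      using invertible_imp_finite_dimensional_hull[OF X2] by blast
    have "z \<in> complex_vector.span (B1 \<union> B2)" for z
    proof -
      obtain x y where "z = x + y" "x \<in> X1" "y \<in> X2"
        using sum by blast
      then show ?thesis
        using B1 B2 complex_vector.span_mono[of B1 "B1 \<union> B2"] complex_vector.span_mono[of B2 "B1 \<union> B2"]
        by (auto intro!: complex_vector.span_add)
    qed
    then show False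
      using assms B1 B2 unfolding finite_dimensional_def by (metis UNIV_eq_I finite_UnI)
  qed
qed

section \<open>The connected component of zero\<close>

text \<open>Sura-Bura gives a relatively clopen compact \<open>K\<close> around the component that
  misses \<mu>. Its complement in the spectrum is the spectral part to which
  \<open>spectral_part_isolated\<close> applies.\<close>

lemma outside_zero_component:
  assumes \<mu>: "\<mu> \<in> \<sigma> T" "\<mu> \<notin> \<sigma>\<^sub>0 T" and "0 \<in> \<sigma> T"
  shows "\<exists>n. \<mu> = deriv \<phi> \<alpha> ^ n" and "\<mu> isolated_in \<sigma> T" and "riesz_point T \<mu>"
proof -
  have comp: "\<sigma>\<^sub>0 T \<in> components (\<sigma> T)"
    using \<open>0 \<in> \<sigma> T\<close> by (auto simp: zero_component_def components_def)
  have lc: "locally compact (\<sigma> T)"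
    using closed_spectrum closed_imp_locally_compact by blast
  have "compact (\<sigma>\<^sub>0 T)"
    using comp compact_spectrum compact_components by blast
  then obtain K where K: "openin (top_of_set (\<sigma> T)) K" "compact K" "\<sigma>\<^sub>0 T \<subseteq> K" "K \<subseteq> - {\<mu>}"
    using Sura_Bura_clopen_subset[OF lc comp, of "- {\<mu>}"] \<mu>(2) by (metis Compl_iff open_Compl closed_singleton singletonD subsetI)
  have KS: "K \<subseteq> \<sigma> T"
    using K(1) openin_imp_subset by blast
  have "closedin (top_of_set (\<sigma> T)) (\<sigma> T - K)"
    using K(1) by (metis closedin_diff closedin_topspace topspace_euclidean_subtopology closedin_def Diff_Diff_Int inf.absorb_iff2 KS Diff_subset)
  then have "compact (\<sigma> T - K)"
    using compact_spectrum closedin_compact by blast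
  moreover have "closed (\<sigma> T - (\<sigma> T - K))"
    using KS K(2) by (simp add: double_diff compact_imp_closed)
  moreover have "0 \<notin> \<sigma> T - K"
    using K(3) \<open>0 \<in> \<sigma> T\<close> connected_component_refl by (force simp: zero_component_def)
  moreover have "\<mu> \<in> \<sigma> T - K"
    using \<mu>(1) K(4) by blast
  ultimately show "\<exists>n. \<mu> = deriv \<phi> \<alpha> ^ n" and "\<mu> isolated_in \<sigma> T" and "riesz_point T \<mu>"
    using spectral_part_isolated[of "\<sigma> T - K" \<mu>] by blast+
qed

text \<open>A connected set with an isolated point is that point alone, so a Riesz point in the
  component would be \<open>0\<close>, already excluded.\<close>

lemma zero_component_not_riesz:
  assumes fin: "\<not> finite_dimensional (UNIV :: 'a set)" and \<mu>: "\<mu> \<in> \<sigma>\<^sub>0 T"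
  shows "\<not> riesz_point T \<mu>"
proof
  assume r: "riesz_point T \<mu>"
  then have "\<mu> isolated_in \<sigma> T"
    unfolding riesz_point_def by (rule conjunct1)
  then obtain U where U: "open U" "U \<inter> \<sigma> T = {\<mu>}"
    unfolding isolated_in_def by blast
  have z: "0 \<in> \<sigma>\<^sub>0 T"
    using zero_in_spectrum(1)[OF fin] by (simp add: zero_component_def)
  have sub: "\<sigma>\<^sub>0 T \<subseteq> \<sigma> T"
    unfolding zero_component_def by (rule connected_component_subset)
  have con: "connected (\<sigma>\<^sub>0 T)"
    unfolding zero_component_def by (rule connected_connected_component)
  have "closed {\<mu>}"
    by simp
  then have "open (- {\<mu>})"
    by (rule open_Compl)
  have "\<mu> = 0"
  proof (rule ccontr)
    assume "\<mu> \<noteq> 0"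
    have "U \<inter> - {\<mu>} \<inter> \<sigma>\<^sub>0 T = {}" "\<sigma>\<^sub>0 T \<subseteq> U \<union> - {\<mu>}"
      using U(2) sub by blast+
    then have "U \<inter> \<sigma>\<^sub>0 T = {} \<or> - {\<mu>} \<inter> \<sigma>\<^sub>0 T = {}"
      by (rule connectedD[OF con U(1) \<open>open (- {\<mu>})\<close>])
    moreover have "\<mu> \<in> U \<inter> \<sigma>\<^sub>0 T"
      using \<mu> U(2) by (metis Int_iff singletonI)
    moreover have "0 \<in> - {\<mu>} \<inter> \<sigma>\<^sub>0 T"
      using z \<open>\<mu> \<noteq> 0\<close> by simp
    ultimately show False
      by (metis empty_iff)
  qed
  then show False
    using r zero_in_spectrum(2)[OF fin] by blast
qed

end

theorem theorem5p9:
  fixes \<phi> :: "complex \<Rightarrow> complex" and \<alpha> :: complex and lam :: "nat \<Rightarrow> complex"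
    and \<iota> :: "'a::complex_banach \<Rightarrow> complex \<Rightarrow> complex" and T :: "'a \<Rightarrow> 'a"
    and J0 :: "nat set"
  assumes "\<phi> holomorphic_on \<D>" and "\<phi> ` \<D> \<subseteq> \<D>" and "\<not> disc_automorphism \<phi>"
    and "\<alpha> \<in> \<D>" and "\<phi> \<alpha> = \<alpha>" and "deriv \<phi> \<alpha> \<noteq> 0"
    and lam: "\<And>n. lam n = deriv \<phi> \<alpha> ^ n"
    and "continuously_embedded_in_Hol \<iota>"
    and invariant: "\<forall>x. \<exists>y. \<forall>z\<in>\<D>. \<iota> y z = (\<iota> x \<circ> \<phi>) z"
    and T: "\<forall>x. \<forall>z\<in>\<D>. \<iota> (T x) z = (\<iota> x \<circ> \<phi>) z"
    and "\<not> finite_dimensional (UNIV :: 'a set)"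
    and J0: "J0 = {n. lam n isolated_in \<sigma> T}"
  shows "\<sigma> T = \<sigma>\<^sub>0 T \<union> {lam n | n. n \<in> J0} \<and> \<sigma>\<^sub>e T = \<sigma>\<^sub>0 T"
proof -
  obtain \<kappa> where \<kappa>: "0 < \<kappa>" "\<kappa> < 1" "\<And>z. z \<in> \<D> \<Longrightarrow> \<exists>C. \<forall>n. norm ((\<phi> ^^ n) z - \<alpha>) \<le> C * \<kappa> ^ n"
    using geometric_convergence_to_fixed_point[OF assms(1-5)] by metis
  have "norm (deriv \<phi> \<alpha>) < 1"
    by (rule interior_fixed_point(1)[OF assms(1-5)])
  then interpret composition_operator \<phi> \<alpha> \<iota> T \<kappa>
    using assms(1,2,4-6,8) T \<kappa> by (intro composition_operator.intro) simp_all
  note fin = assms(11)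
  note zero = zero_in_spectrum(1)[OF fin]
  have sub: "\<sigma>\<^sub>0 T \<subseteq> \<sigma> T"
    unfolding zero_component_def by (rule connected_component_subset)
  have "\<mu> \<in> \<sigma>\<^sub>0 T \<union> {lam n | n. n \<in> J0}" if "\<mu> \<in> \<sigma> T" for \<mu>
    using outside_zero_component(1,2)[OF that _ zero] J0 lam by fastforce
  moreover have "lam n \<in> \<sigma> T" if "n \<in> J0" for n
    using that unfolding J0 isolated_in_def by blast
  ultimately have "\<sigma> T = \<sigma>\<^sub>0 T \<union> {lam n | n. n \<in> J0}"
    using sub by blast
  \<comment> \<open>Off the component every spectral point is a Riesz point, and on it none
    is.\<close>
  moreover have "\<sigma>\<^sub>e T = \<sigma>\<^sub>0 T"
    unfolding essential_spectrum_def
    using sub outside_zero_component(3)[OF _ _ zero] zero_component_not_riesz[OF fin] by blast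
  ultimately show ?thesis ..
qed

end
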